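(* There is an algorithm that solves the \textsc{Dual Weighted Coloring} problem in time $9^k \cdot n^{\mathcal{O}(1)}$, where $n$ is the number of vertices of the input graph.
   Context: All graphs are finite, simple and undirected. A proper $k$-coloring of a graph $G$ is a partition of $V(G)$ into stable (independent) sets $S_1,\ldots,S_k$, called colors. Given a weight function $w: V(G)\to \mathbb{Z}_{>0}$ (vertex weights are positive integers), the weight of a color $S_i$ is $w(i)=\max_{v\in S_i} w(v)$, and the weight of a coloring $c$ is $w(c)=\sum_{i=1}^k w(i)$. The weighted chromatic number $\sigma(G,w)$ is the minimum weight of a proper coloring of $G$ (over all numbers of colors). \textsc{Dual Weighted Coloring}: given a vertex-weighted graph $(G,w)$ with positive integer weights and a positive integer $k$ (the parameter), decide whether $\sigma(G,w)\le \sum_{v\in V(G)} w(v) - k$. *)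

theory Defs
  imports "Graph_Theory.Pair_Digraph" "HOL-Library.Disjoint_Sets"
begin

section \<open>Weighted colorings\<close>

text \<open>
  A finite simple undirected graph is a \<^locale>\<open>pair_graph\<close>: a finite, loop-free, symmetric
  arc relation, each edge being present as two opposite arcs.
\<close>

definition stable_set :: "'a pair_pre_digraph \<Rightarrow> 'a set \<Rightarrow> bool" where
  "stable_set G S \<longleftrightarrow> S \<subseteq> pverts G \<and> (\<forall>u\<in>S. \<forall>v\<in>S. (u, v) \<notin> parcs G)"

definition proper_coloring :: "'a pair_pre_digraph \<Rightarrow> nat \<Rightarrow> 'a set set \<Rightarrow> bool" where
  "proper_coloring G k \<C> \<longleftrightarrow>
     partition_on (pverts G) \<C> \<and> card \<C> = k \<and> (\<forall>S\<in>\<C>. stable_set G S)"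

definition color_weight :: "('a \<Rightarrow> nat) \<Rightarrow> 'a set \<Rightarrow> nat" where
  "color_weight w S = Max (w ` S)"

definition coloring_weight :: "('a \<Rightarrow> nat) \<Rightarrow> 'a set set \<Rightarrow> nat" where
  "coloring_weight w \<C> = (\<Sum>S\<in>\<C>. color_weight w S)"

definition weighted_chromatic_number :: "'a pair_pre_digraph \<Rightarrow> ('a \<Rightarrow> nat) \<Rightarrow> nat" where
  "weighted_chromatic_number G w = Min {coloring_weight w \<C> |\<C> k. proper_coloring G k \<C>}"

lemma finite_coloring_weights:
  assumes "pair_graph G"
  shows "finite {coloring_weight w \<C> |\<C> k. proper_coloring G k \<C>}"
proof -
  interpret pair_graph G by fact
  have "{coloring_weight w \<C> |\<C> k. proper_coloring G k \<C>}
      \<subseteq> coloring_weight w ` Pow (Pow (pverts G))"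
    unfolding proper_coloring_def partition_on_def by auto
  then show ?thesis
    by (rule finite_subset) (use pair_finite_verts in simp)
qed

lemma coloring_weights_nonempty:
  assumes "pair_graph G"
  shows "{coloring_weight w \<C> |\<C> k. proper_coloring G k \<C>} \<noteq> {}"
proof -
  interpret pair_graph G by fact
  have "partition_on (pverts G) ((\<lambda>v. {v}) ` pverts G)"
    by (rule partition_onI) (auto simp: disjnt_def)
  moreover have "\<forall>S\<in>(\<lambda>v. {v}) ` pverts G. stable_set G S"
    using pair_no_loops by (force simp: stable_set_def)
  ultimately have "proper_coloring G (card ((\<lambda>v. {v}) ` pverts G)) ((\<lambda>v. {v}) ` pverts G)"
    unfolding proper_coloring_def by simp
  then show ?thesis by blast
qed

text \<open>
  The subtraction is over the integers, hence not truncated: an instance with \<open>k\<close> larger than the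
  total weight is a no-instance.
\<close>

definition dual_weighted_coloring :: "'a pair_pre_digraph \<Rightarrow> ('a \<Rightarrow> nat) \<Rightarrow> nat \<Rightarrow> bool" where
  "dual_weighted_coloring G w k \<longleftrightarrow>
     int (weighted_chromatic_number G w) \<le> int (\<Sum>v\<in>pverts G. w v) - int k"


section \<open>Algorithms and running time\<close>

text \<open>
  Algorithms are programs of a deterministic, structured, uniform-cost random access machine over
  the integers. The memory consists of arrays \<open>x\<close>, indexed by the integers, of which a program
  mentions only finitely many; a scalar variable is the cell \<open>x[0]\<close>. Every evaluated operator,
  constant, memory access, test and assignment takes one unit of time. The only arithmetic
  operations are addition and subtraction: in \<open>t\<close> steps the bit length of the numbers grows by
  only \<open>O(t)\<close>, so the unit cost does not hide super-polynomial computations, as it would with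
  multiplication or bit-parallel operations.
\<close>

type_synonym vname = string
type_synonym state = "vname \<Rightarrow> int \<Rightarrow> int"

datatype aexp = Const int | Cell vname aexp | Plus aexp aexp | Minus aexp aexp

datatype bexp = Less aexp aexp | Not bexp | And bexp bexp

datatype com =
    Skip
  | Assign vname aexp aexp \<comment> \<open>\<open>Assign x i a\<close> is \<open>x[i] := a\<close>\<close>
  | Seq com com
  | If bexp com com
  | While bexp com

primrec aval :: "aexp \<Rightarrow> state \<Rightarrow> int" where
  "aval (Const z) s = z"
| "aval (Cell x i) s = s x (aval i s)"
| "aval (Plus a b) s = aval a s + aval b s"
| "aval (Minus a b) s = aval a s - aval b s"

primrec acost :: "aexp \<Rightarrow> nat" where
  "acost (Const z) = 1"
| "acost (Cell x i) = 1 + acost i"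
| "acost (Plus a b) = 1 + acost a + acost b"
| "acost (Minus a b) = 1 + acost a + acost b"

primrec bval :: "bexp \<Rightarrow> state \<Rightarrow> bool" where
  "bval (Less a b) s \<longleftrightarrow> aval a s < aval b s"
| "bval (Not b) s \<longleftrightarrow> \<not> bval b s"
| "bval (And b c) s \<longleftrightarrow> bval b s \<and> bval c s"

primrec bcost :: "bexp \<Rightarrow> nat" where
  "bcost (Less a b) = 1 + acost a + acost b"
| "bcost (Not b) = 1 + bcost b"
| "bcost (And b c) = 1 + bcost b + bcost c"

text \<open>\<open>exec c s t s'\<close>: started in \<open>s\<close>, the program \<open>c\<close> halts in \<open>s'\<close> after exactly \<open>t\<close> steps.\<close>

inductive exec :: "com \<Rightarrow> state \<Rightarrow> nat \<Rightarrow> state \<Rightarrow> bool" where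
  Skip: "exec Skip s 1 s"
| Assign: "exec (Assign x i a) s (1 + acost i + acost a) (s(x := (s x)(aval i s := aval a s)))"
| Seq: "exec c1 s1 t1 s2 \<Longrightarrow> exec c2 s2 t2 s3 \<Longrightarrow> exec (Seq c1 c2) s1 (t1 + t2) s3"
| IfTrue: "bval b s \<Longrightarrow> exec c1 s t s' \<Longrightarrow> exec (If b c1 c2) s (1 + bcost b + t) s'"
| IfFalse: "\<not> bval b s \<Longrightarrow> exec c2 s t s' \<Longrightarrow> exec (If b c1 c2) s (1 + bcost b + t) s'"
| WhileFalse: "\<not> bval b s \<Longrightarrow> exec (While b c) s (1 + bcost b) s"
| WhileTrue: "bval b s1 \<Longrightarrow> exec c s1 t1 s2 \<Longrightarrow> exec (While b c) s2 t2 s3 \<Longrightarrow>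
    exec (While b c) s1 (1 + bcost b + t1 + t2) s3"

inductive_cases SkipE: "exec Skip s t s'"
inductive_cases AssignE: "exec (Assign x i a) s t s'"
inductive_cases SeqE: "exec (Seq c1 c2) s t s'"
inductive_cases IfE: "exec (If b c1 c2) s t s'"
inductive_cases WhileE: "exec (While b c) s t s'"

lemma exec_deterministic:
  "exec c s t s' \<Longrightarrow> exec c s u s'' \<Longrightarrow> u = t \<and> s'' = s'"
proof (induction arbitrary: u s'' rule: exec.induct)
  case Skip
  then show ?case by (auto elim: SkipE)
next
  case Assign
  then show ?case by (auto elim: AssignE)
next
  case (Seq c1 s1 t1 s2 c2 t2 s3)
  from Seq.prems show ?case
    by (rule SeqE) (auto dest!: Seq.IH)
next
  case (IfTrue b s c1 t s' c2)
  from IfTrue.prems show ?case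
    by (rule IfE) (auto dest!: IfTrue.IH simp: IfTrue.hyps)
next
  case (IfFalse b s c2 t s' c1)
  from IfFalse.prems show ?case
    by (rule IfE) (auto dest!: IfFalse.IH simp: IfFalse.hyps)
next
  case (WhileFalse b s c)
  from WhileFalse.prems show ?case
    by (rule WhileE) (auto simp: WhileFalse.hyps)
next
  case (WhileTrue b s1 c t1 s2 t2 s3)
  from WhileTrue.prems show ?case
    by (rule WhileE) (auto dest!: WhileTrue.IH simp: WhileTrue.hyps)
qed


section \<open>Instances and their encoding\<close>

text \<open>As usual for algorithmic input, the \<open>n\<close> vertices are labelled \<open>0, \<dots>, n - 1\<close>.\<close>

definition dwc_instance :: "nat pair_pre_digraph \<Rightarrow> (nat \<Rightarrow> nat) \<Rightarrow> nat \<Rightarrow> bool" where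
  "dwc_instance G w k \<longleftrightarrow>
     pair_graph G \<and> pverts G = {..<card (pverts G)} \<and> (\<forall>v\<in>pverts G. 0 < w v) \<and> 0 < k"

text \<open>
  The graph is given by its row-major adjacency matrix: \<open>adj[u * n + v]\<close> is \<open>1\<close> or \<open>0\<close>. All cells
  that hold no input are \<open>0\<close>.
\<close>

definition encode :: "nat pair_pre_digraph \<Rightarrow> (nat \<Rightarrow> nat) \<Rightarrow> nat \<Rightarrow> state" where
  "encode G w k = (let n = card (pverts G) in (\<lambda>_ _. 0)
     (''n'' := \<lambda>i. if i = 0 then int n else 0,
      ''k'' := \<lambda>i. if i = 0 then int k else 0,
      ''w'' := \<lambda>i. if 0 \<le> i \<and> i < int n then int (w (nat i)) else 0,
      ''adj'' := \<lambda>i. if \<exists>u<n. \<exists>v<n. i = int (u * n + v) \<and> (u, v) \<in> parcs G then 1 else 0))"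

end

theory Submission
  imports Defs "HOL-Library.Nat_Bijection"
begin

text \<open>
  Greedily choose a maximal set of disjoint pairs of non-adjacent vertices. Making each of \<open>k\<close> such
  pairs a color, and every other vertex a color of its own, already saves weight \<open>k\<close>. Otherwise
  the chosen pairs cover a set \<open>X\<close> of fewer than \<open>2k\<close> vertices, and the vertices outside \<open>X\<close> form
  a clique, so every color is a stable subset of \<open>X\<close> plus at most one further vertex. A dynamic
  program treats one vertex \<open>v\<close> at a time and computes for every \<open>S \<subseteq> X\<close> the largest weight that
  can be saved on \<open>S\<close> by the colors represented by the vertices up to \<open>v\<close>. Each step ranges over
  the pairs \<open>T \<subseteq> S \<subseteq> X\<close>, of which there are less than \<open>3 ^ (2 * k) = 9 ^ k\<close>.
\<close>

section \<open>Running times of structured programs\<close>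

text \<open>What is maximized is saved weight, the sum minus the maximum over a color, rather than
  minimized total weight: leftover singletons and empty sets save nothing, so a family of disjoint
  stable sets need not be completed to a partition inside the recurrence. Every vertex acts once as
  a representative, modulator vertices included, because a color inside \<open>X\<close> needs an
  owner too; both kinds then pass through one recurrence. The clique outside \<open>X\<close> gives
  each color at most one outer vertex, so its owner among the outer vertices is unambiguous. The
  machine has neither multiplication nor bit operations. Hence subsets are codes, tables grow by
  doubling, and a pair \<open>T\<close>, \<open>S\<close> with \<open>T\<close> inside
  \<open>S\<close> is stored as the disjoint pair of \<open>T\<close> and \<open>S - T\<close>,
  whose codes simply add up to that of \<open>S\<close>. These pairs are listed once, by tripling,
  so there are \<open>3 ^ m\<close> of them for \<open>m\<close> the size of \<open>X\<close>.
  Stability of \<open>T\<close> together with a vertex is tested in constant time from tabulated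
  conflict counts. Apart from the factor \<open>3 ^ m\<close> there are at most two nested loops
  over vertices, which gives the factor \<open>(n + 1) * (n + 1)\<close>.\<close>

definition runs :: "com \<Rightarrow> state \<Rightarrow> nat \<Rightarrow> (state \<Rightarrow> bool) \<Rightarrow> bool" where
  "runs c s T Q \<longleftrightarrow> (\<exists>t s'. exec c s t s' \<and> t \<le> T \<and> Q s')"

primrec mods :: "com \<Rightarrow> vname set" where
  "mods Skip = {}"
| "mods (Assign x i a) = {x}"
| "mods (Seq c d) = mods c \<union> mods d"
| "mods (If b c d) = mods c \<union> mods d"
| "mods (While b c) = mods c"

lemma exec_frame: "exec c s t s' \<Longrightarrow> x \<notin> mods c \<Longrightarrow> s' x = s x"
  by (induction rule: exec.induct) auto

lemma runs_frame:
  "runs c s T Q \<Longrightarrow> runs c s T (\<lambda>s'. Q s' \<and> (\<forall>x. x \<notin> mods c \<longrightarrow> s' x = s x))"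
  unfolding runs_def using exec_frame by blast

lemma runs_mono:
  "runs c s T Q \<Longrightarrow> T \<le> T' \<Longrightarrow> (\<And>s'. Q s' \<Longrightarrow> R s') \<Longrightarrow> runs c s T' R"
  unfolding runs_def by (meson order_trans)

text \<open>The frame condition of the first program is handed on to the proof for the second, so
  that postconditions have to mention only what has changed.\<close>

lemma runs_Seq:
  assumes "runs c s T1 Q" "T1 + T2 \<le> T"
    and "\<And>s'. Q s' \<Longrightarrow> \<forall>x. x \<notin> mods c \<longrightarrow> s' x = s x \<Longrightarrow> runs d s' T2 R"
  shows "runs (Seq c d) s T R"
proof -
  obtain t s' where 1: "exec c s t s'" "t \<le> T1" "Q s'" "\<forall>x. x \<notin> mods c \<longrightarrow> s' x = s x"
    using runs_frame[OF assms(1)] unfolding runs_def by blast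
  from assms(3)[OF 1(3,4)] obtain t' s'' where 2: "exec d s' t' s''" "t' \<le> T2" "R s''"
    unfolding runs_def by blast
  show ?thesis
    unfolding runs_def using exec.Seq[OF 1(1) 2(1)] 1(2) 2(2,3) assms(2)
    by (metis add_mono order_trans)
qed

lemma runs_If:
  assumes "bval b s \<Longrightarrow> runs c s T Q" "\<not> bval b s \<Longrightarrow> runs d s T Q" "1 + bcost b + T \<le> T'"
  shows "runs (If b c d) s T' Q"
proof (cases "bval b s")
  case True
  then obtain t s' where "exec c s t s'" "t \<le> T" "Q s'"
    using assms(1) unfolding runs_def by blast
  then show ?thesis
    unfolding runs_def using IfTrue[OF True] assms(3)
    by (metis add_le_mono dual_order.refl order_trans)
next
  case False
  then obtain t s' where "exec d s t s'" "t \<le> T" "Q s'"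
    using assms(2) unfolding runs_def by blast
  then show ?thesis
    unfolding runs_def using IfFalse[OF False] assms(3)
    by (metis add_le_mono dual_order.refl order_trans)
qed

section \<open>Straight-line programs\<close>

primrec loop_free :: "com \<Rightarrow> bool" where
  "loop_free Skip = True"
| "loop_free (Assign x i a) = True"
| "loop_free (Seq c d) = (loop_free c \<and> loop_free d)"
| "loop_free (If b c d) = (loop_free c \<and> loop_free d)"
| "loop_free (While b c) = False"

primrec loop_free_result :: "com \<Rightarrow> state \<Rightarrow> state" where
  "loop_free_result Skip s = s"
| "loop_free_result (Assign x i a) s = s(x := (s x)(aval i s := aval a s))"
| "loop_free_result (Seq c d) s = loop_free_result d (loop_free_result c s)"
| "loop_free_result (If b c d) s =
    (if bval b s then loop_free_result c s else loop_free_result d s)"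
| "loop_free_result (While b c) s = s"

primrec loop_free_cost :: "com \<Rightarrow> nat" where
  "loop_free_cost Skip = 1"
| "loop_free_cost (Assign x i a) = 1 + acost i + acost a"
| "loop_free_cost (Seq c d) = loop_free_cost c + loop_free_cost d"
| "loop_free_cost (If b c d) = 1 + bcost b + max (loop_free_cost c) (loop_free_cost d)"
| "loop_free_cost (While b c) = 0"

lemma exec_loop_free:
  "loop_free c \<Longrightarrow> \<exists>t. exec c s t (loop_free_result c s) \<and> t \<le> loop_free_cost c"
proof (induction c arbitrary: s)
  case (Seq c d)
  then obtain t u where "exec c s t (loop_free_result c s)" "t \<le> loop_free_cost c"
    "exec d (loop_free_result c s) u (loop_free_result d (loop_free_result c s))"
    "u \<le> loop_free_cost d"
    by fastforce
  then show ?case by (auto intro!: exI exec.Seq)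
next
  case (If b c d)
  then obtain t u where "exec c s t (loop_free_result c s)" "t \<le> loop_free_cost c"
    "exec d s u (loop_free_result d s)" "u \<le> loop_free_cost d"
    by fastforce
  then show ?case
    by (cases "bval b s") (force intro: IfTrue IfFalse)+
qed (auto intro: exec.intros)

text \<open>Straight-line code is verified by evaluation: the simplifier computes the final state
  and the cost, without intermediate assertions.\<close>

lemma runs_loop_free:
  "loop_free c \<Longrightarrow> loop_free_cost c \<le> T \<Longrightarrow> Q (loop_free_result c s) \<Longrightarrow> runs c s T Q"
  unfolding runs_def using exec_loop_free by (meson order_trans)

abbreviation Var :: "vname \<Rightarrow> aexp" where "Var x \<equiv> Cell x (Const 0)"

abbreviation SetVar :: "vname \<Rightarrow> aexp \<Rightarrow> com" where "SetVar x a \<equiv> Assign x (Const 0) a"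

section \<open>Counting loops\<close>

definition For :: "vname \<Rightarrow> vname \<Rightarrow> com \<Rightarrow> com" where
  "For i N c = Seq (SetVar i (Const 0))
     (While (Less (Var i) (Var N)) (Seq c (SetVar i (Plus (Var i) (Const 1)))))"

lemma mods_For [simp]: "mods (For i N c) = insert i (mods c)"
  by (auto simp: For_def)

text \<open>The counter is incremented after the body has established the next invariant, so the
  invariant must survive changes of \<open>i\<close>. On top of \<open>B\<close>, a round costs 6
  for the test and 6 for the increment; the 9 consists of the initialization (3) and the last,
  failing test (6).\<close>

lemma runs_For:
  assumes vars: "i \<notin> mods c" "N \<notin> mods c" "i \<noteq> N"
    and N: "s N 0 = int n"
    and init: "Inv 0 s"
    and stable: "\<And>j s z. Inv j s \<Longrightarrow> Inv j (s(i := z))"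
    and body: "\<And>j s'. \<lbrakk>j < n; s' i 0 = int j; Inv j s'; \<forall>x. x \<notin> insert i (mods c) \<longrightarrow> s' x = s x\<rbrakk>
        \<Longrightarrow> runs c s' B (Inv (Suc j))"
    and T: "n * (B + 12) + 9 \<le> T"
  shows "runs (For i N c) s T (Inv n)"
proof -
  let ?b = "Less (Var i) (Var N)" and ?inc = "SetVar i (Plus (Var i) (Const 1))"
  let ?W = "While ?b (Seq c ?inc)"
  have loop: "runs ?W s' ((n - j) * (B + 12) + 6) (Inv n)"
    if "j \<le> n" "s' i 0 = int j" "Inv j s'" "\<forall>x. x \<notin> insert i (mods c) \<longrightarrow> s' x = s x" for j s'
    using that
  proof (induction "n - j" arbitrary: j s')
    case 0
    with vars N have "\<not> bval ?b s'" by simp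
    from WhileFalse[OF this] 0 show ?case unfolding runs_def by fastforce
  next
    case (Suc d)
    with vars N have b: "bval ?b s'" by simp
    have "j < n" using Suc.hyps by simp
    from body[OF this Suc.prems(2-4)]
    obtain t s1 where 1: "exec c s' t s1" "t \<le> B" "Inv (Suc j) s1"
      unfolding runs_def by blast
    let ?s2 = "s1(i := (s1 i)(0 := s1 i 0 + 1))"
    have fr: "s1 x = s' x" if "x \<notin> mods c" for x
      using exec_frame[OF 1(1) that] .
    have inc: "exec ?inc s1 6 ?s2"
      using exec.Assign[of i "Const 0" "Plus (Var i) (Const 1)" s1] by (simp add: eval_nat_numeral)
    have "runs ?W ?s2 ((n - Suc j) * (B + 12) + 6) (Inv n)"
    proof (rule Suc.hyps(1))
      show "?s2 i 0 = int (Suc j)" using fr[OF vars(1)] Suc.prems by simp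
    qed (use Suc.hyps Suc.prems fr stable[OF 1(3)] in auto)
    then obtain u s3 where 3: "exec ?W ?s2 u s3" "u \<le> (n - Suc j) * (B + 12) + 6" "Inv n s3"
      unfolding runs_def by blast
    have "exec ?W s' (1 + bcost ?b + (t + 6) + u) s3"
      by (rule WhileTrue[OF b exec.Seq[OF 1(1) inc] 3(1)])
    moreover have "n - j = Suc (n - Suc j)" using Suc.hyps by simp
    then have "1 + bcost ?b + (t + 6) + u \<le> (n - j) * (B + 12) + 6"
      using 1(2) 3(2) by simp
    ultimately show ?case unfolding runs_def using 3(3) by blast
  qed
  show ?thesis
    unfolding For_def
  proof (rule runs_Seq[where ?T1.0 = 3 and ?T2.0 = "n * (B + 12) + 6"])
    show "runs (SetVar i (Const 0)) s 3 (\<lambda>s'. Inv 0 s' \<and> s' i 0 = 0)"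
      by (rule runs_loop_free) (auto intro: stable init)
  qed (use loop[of 0] T in auto)
qed

text \<open>All cost bounds below have the shape \<open>constant * product of loop lengths\<close>; this is how such
  a bound passes through one more loop.\<close>

lemma loop_cost:
  fixes a :: nat
  assumes "B \<le> a * Q" "0 < Q" "l \<le> R" "0 < R" "a + 21 \<le> b"
  shows "l * (B + 12) + 9 \<le> b * (R * Q)"
proof -
  have "l * (B + 12) \<le> R * ((a + 12) * Q)"
    by (rule mult_le_mono) (use assms in \<open>auto simp: algebra_simps\<close>)
  moreover have "1 \<le> R * Q" using assms(2,4) by (simp add: Suc_le_eq)
  ultimately have "l * (B + 12) + 9 \<le> (a + 12) * (R * Q) + 9 * (R * Q)"
    by (smt (verit) add_mono mult.assoc mult.commute mult_le_mono2 nat_mult_1_right)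
  then have "l * (B + 12) + 9 \<le> (a + 21) * (R * Q)" by (simp add: algebra_simps)
  also have "\<dots> \<le> b * (R * Q)" using assms(5) by (rule mult_le_mono1)
  finally show ?thesis .
qed

lemma add_cost:
  fixes Q :: nat
  assumes "0 < Q" "c + a \<le> b"
  shows "c + a * Q \<le> b * Q" "a * Q + c \<le> b * Q"
proof -
  have "c * 1 \<le> c * Q" using assms(1) by (intro mult_le_mono2) simp
  moreover have "(c + a) * Q \<le> b * Q" using assms(2) by (rule mult_le_mono1)
  ultimately show "c + a * Q \<le> b * Q" "a * Q + c \<le> b * Q"
    unfolding add_mult_distrib by linarith+
qed

section \<open>Colorings from families of disjoint stable sets\<close>

lemma dual_weighted_coloring_iff:
  assumes "pair_graph G"
  shows "dual_weighted_coloring G w k \<longleftrightarrow>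
    (\<exists>\<C> l. proper_coloring G l \<C> \<and> coloring_weight w \<C> + k \<le> (\<Sum>v\<in>pverts G. w v))"
proof -
  let ?A = "{coloring_weight w \<C> |\<C> k. proper_coloring G k \<C>}"
  have "dual_weighted_coloring G w k \<longleftrightarrow> Min ?A + k \<le> (\<Sum>v\<in>pverts G. w v)"
    unfolding dual_weighted_coloring_def weighted_chromatic_number_def by linarith
  also have "\<dots> \<longleftrightarrow> (\<exists>a\<in>?A. a + k \<le> (\<Sum>v\<in>pverts G. w v))"
    using Min_in[OF finite_coloring_weights coloring_weights_nonempty, OF assms assms, of w]
      Min_le[OF finite_coloring_weights[OF assms, of w]]
    by (meson add_le_mono1 order_trans)
  finally show ?thesis by blast
qed

text \<open>The nonempty members become colors and every uncovered vertex a color of its own, which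
  saves nothing. Both the large matching and the dynamic program use this. The latter also produces
  empty members; \<open>insert 0\<close> makes their saving 0.\<close>

lemma dual_weighted_coloring_if_disjoint_stable:
  assumes G: "pair_graph G" and fin: "finite I" and disj: "disjoint_family_on D I"
    and stable: "\<And>i. i \<in> I \<Longrightarrow> stable_set G (D i)"
    and k: "int k \<le> (\<Sum>i\<in>I. (\<Sum>v\<in>D i. int (w v)) - int (Max (insert 0 (w ` D i))))"
  shows "dual_weighted_coloring G w k"
proof -
  interpret pair_graph G by fact
  let ?V = "pverts G"
  define J where "J = {i \<in> I. D i \<noteq> {}}"
  define R where "R = ?V - \<Union> (D ` J)"
  define \<C> where "\<C> = D ` J \<union> (\<lambda>v. {v}) ` R"
  have J: "finite J" "J \<subseteq> I" using fin by (auto simp: J_def)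
  have sub: "D i \<subseteq> ?V" if "i \<in> J" for i
    using stable that J by (auto simp: stable_set_def)
  have fD: "finite (D i)" if "i \<in> J" for i
    using sub[OF that] pair_finite_verts finite_subset by blast
  have fR: "finite R" using pair_finite_verts by (simp add: R_def)
  have dj: "D i \<inter> D j = {}" if "i \<in> J" "j \<in> J" "i \<noteq> j" for i j
    using disj that J by (auto simp: disjoint_family_on_def)
  \<comment> \<open>Disjoint sets can coincide only if they are empty, which \<open>J\<close>
    excludes.\<close>
  have inj: "inj_on D J"
    by (rule inj_onI) (use dj in \<open>fastforce simp: J_def\<close>)
  have "partition_on ?V \<C>"
  proof (rule partition_onI)
    show "\<Union> \<C> = ?V" using sub by (auto simp: \<C>_def R_def)
    show "{} \<notin> \<C>" by (auto simp: \<C>_def J_def)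
    show "disjnt p q" if "p \<in> \<C>" "q \<in> \<C>" "p \<noteq> q" for p q
    proof -
      have "disjnt (D i) (D j)" if "i \<in> J" "j \<in> J" "D i \<noteq> D j" for i j
        using dj[OF that(1,2)] that(3) by (auto simp: disjnt_def)
      moreover have "disjnt (D i) {v}" "disjnt {v} (D i)" if "i \<in> J" "v \<in> R" for i v
        using that by (auto simp: R_def disjnt_def)
      ultimately show ?thesis
        using that unfolding \<C>_def by (elim UnE imageE) simp_all
    qed
  qed
  moreover have "\<forall>S\<in>\<C>. stable_set G S"
    using stable J pair_no_loops by (fastforce simp: \<C>_def R_def stable_set_def)
  ultimately have C: "proper_coloring G (card \<C>) \<C>"
    by (simp add: proper_coloring_def)
  have "coloring_weight w \<C>
      = (\<Sum>S\<in>D ` J. color_weight w S) + (\<Sum>S\<in>(\<lambda>v. {v}) ` R. color_weight w S)"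
    unfolding coloring_weight_def \<C>_def
    by (rule sum.union_disjoint) (use J fR in \<open>auto simp: R_def\<close>)
  also have "\<dots> = (\<Sum>i\<in>J. Max (w ` D i)) + (\<Sum>v\<in>R. w v)"
    by (subst (1 2) sum.reindex) (auto simp: inj color_weight_def)
  finally have weight: "coloring_weight w \<C> = (\<Sum>i\<in>J. Max (w ` D i)) + (\<Sum>v\<in>R. w v)" .
  have "(\<Sum>v\<in>?V. w v) = (\<Sum>v\<in>\<Union> (D ` J). w v) + (\<Sum>v\<in>R. w v)"
    unfolding R_def using sub pair_finite_verts
    by (subst add.commute, intro sum.subset_diff) auto
  also have "(\<Sum>v\<in>\<Union> (D ` J). w v) = (\<Sum>i\<in>J. \<Sum>v\<in>D i. w v)"
    by (rule sum.UNION_disjoint) (use J fD dj in auto)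
  finally have total: "(\<Sum>v\<in>?V. w v) = (\<Sum>i\<in>J. \<Sum>v\<in>D i. w v) + (\<Sum>v\<in>R. w v)" .
  have "(\<Sum>i\<in>I. (\<Sum>v\<in>D i. int (w v)) - int (Max (insert 0 (w ` D i))))
      = (\<Sum>i\<in>J. (\<Sum>v\<in>D i. int (w v)) - int (Max (w ` D i)))"
    by (rule sum.mono_neutral_cong_right) (use fin J fD in \<open>auto simp: J_def\<close>)
  then have "int (coloring_weight w \<C> + k) \<le> int (\<Sum>v\<in>?V. w v)"
    unfolding weight total using k by (simp add: sum_subtractf)
  then show ?thesis
    unfolding dual_weighted_coloring_iff[OF G] using C by (auto simp only: of_nat_le_iff)
qed


section \<open>The dynamic program\<close>

text \<open>The enumeration \<open>xs\<close> of the modulator turns its subsets into sets of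
  indices below \<open>m\<close>, whose codes can address table cells.\<close>

locale clique_modulator =
  fixes G :: "nat pair_pre_digraph" and w :: "nat \<Rightarrow> nat" and n m :: nat and xs :: "nat \<Rightarrow> nat"
  assumes graph: "pair_graph G" and verts: "pverts G = {..<n}"
    and inj: "inj_on xs {..<m}" and xs_less: "\<And>i. i < m \<Longrightarrow> xs i < n"
    and clique: "\<And>u v. \<lbrakk>u < n; v < n; u \<noteq> v; u \<notin> xs ` {..<m}; v \<notin> xs ` {..<m}\<rbrakk> \<Longrightarrow> (u, v) \<in> parcs G"
begin

text \<open>Sets of modulator vertices are represented by sets of indices. A color is described by the
  set of indices of its modulator vertices and a representative \<open>v\<close>, which is its vertex outside
  the modulator if there is one, and otherwise one of the modulator vertices; in the second case
  the representative must not be counted again, hence the weight \<open>0\<close>.\<close>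

definition rep_weight :: "nat \<Rightarrow> int" where
  "rep_weight v = (if v \<in> xs ` {..<m} then 0 else int (w v))"

definition conflicts :: "nat \<Rightarrow> nat set \<Rightarrow> int" where
  "conflicts v S = (\<Sum>i\<in>S. if (v, xs i) \<in> parcs G then 1 else 0)"

text \<open>Every edge is counted once, at its endpoint of larger index. A new largest index
  therefore just adds its own conflicts, which is the recurrence behind the table
  \<open>bad\<close>.\<close>

definition inner_conflicts :: "nat set \<Rightarrow> int" where
  "inner_conflicts S = (\<Sum>i\<in>S. conflicts (xs i) (S \<inter> {..<i}))"

definition total :: "nat set \<Rightarrow> int" where
  "total S = (\<Sum>i\<in>S. int (w (xs i)))"

definition heaviest :: "nat set \<Rightarrow> int" where
  "heaviest S = int (Max (insert 0 ((\<lambda>i. w (xs i)) ` S)))"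

text \<open>Both counts are nonnegative, so both have to vanish; the form is that of the machine's
  test, whose only comparison is \<open>Less\<close>.\<close>

definition compatible :: "nat set \<Rightarrow> nat \<Rightarrow> bool" where
  "compatible S v \<longleftrightarrow> inner_conflicts S + conflicts v S < 1"

definition saving :: "nat set \<Rightarrow> nat \<Rightarrow> int" where
  "saving S v = total S + rep_weight v - max (heaviest S) (rep_weight v)"

primrec opt :: "nat \<Rightarrow> nat set \<Rightarrow> int" where
  "opt 0 S = 0"
| "opt (Suc v) S = Max ((\<lambda>T. opt v (S - T) + saving T v) ` {T. T \<subseteq> S \<and> compatible T v})"

lemma conflicts_nonneg: "0 \<le> conflicts v S"
  unfolding conflicts_def by (rule sum_nonneg) simp

lemma conflicts_eq_0_iff:
  "finite S \<Longrightarrow> conflicts v S = 0 \<longleftrightarrow> (\<forall>i\<in>S. (v, xs i) \<notin> parcs G)"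
  unfolding conflicts_def by (subst sum_nonneg_eq_0_iff) auto

lemma inner_conflicts_nonneg: "0 \<le> inner_conflicts S"
  unfolding inner_conflicts_def by (rule sum_nonneg) (simp add: conflicts_nonneg)

lemma compatible_empty [simp]: "compatible {} v"
  by (simp add: compatible_def inner_conflicts_def conflicts_def)

lemma saving_empty [simp]: "saving {} v = 0"
  by (simp add: saving_def total_def heaviest_def rep_weight_def)

lemma compatible_iff:
  assumes S: "S \<subseteq> {..<m}"
  shows "compatible S v \<longleftrightarrow> stable_set G (xs ` S) \<and> (\<forall>i\<in>S. (v, xs i) \<notin> parcs G)"
proof -
  interpret pair_graph G by (rule graph)
  have fin: "finite S" using S finite_subset by blast
  have sym: "(b, a) \<in> parcs G" if "(a, b) \<in> parcs G" for a b
    using that pair_sym_arcs by (auto simp: symmetric_def dest: symD)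
  have irr: "(a, a) \<notin> parcs G" for a
    using pair_no_loops by fastforce
  have "compatible S v \<longleftrightarrow> inner_conflicts S = 0 \<and> conflicts v S = 0"
    unfolding compatible_def
    using inner_conflicts_nonneg[of S] conflicts_nonneg[of v S] by linarith
  also have "inner_conflicts S = 0 \<longleftrightarrow> (\<forall>i\<in>S. \<forall>j\<in>S \<inter> {..<i}. (xs i, xs j) \<notin> parcs G)"
    unfolding inner_conflicts_def
    by (subst sum_nonneg_eq_0_iff) (auto simp: fin conflicts_nonneg conflicts_eq_0_iff)
  \<comment> \<open>Symmetry and irreflexivity of the arcs extend the condition from
    \<open>j < i\<close> to all pairs.\<close>
  also have "\<dots> \<longleftrightarrow> (\<forall>i\<in>S. \<forall>j\<in>S. (xs i, xs j) \<notin> parcs G)"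
    using sym irr by (metis IntE IntI lessThan_iff linorder_cases)
  also have "\<dots> \<longleftrightarrow> stable_set G (xs ` S)"
    using S xs_less by (auto simp: stable_set_def verts)
  finally show ?thesis by (simp add: conflicts_eq_0_iff fin)
qed

definition color_of :: "nat set \<Rightarrow> nat \<Rightarrow> nat set" where
  "color_of T v = xs ` T \<union> (if v \<in> xs ` {..<m} then {} else {v})"

text \<open>Links the arithmetic of the recurrence to actual colors. A modulator representative
  enters with weight 0, which is neutral in the sum and, as \<open>heaviest\<close> is nonnegative,
  in the maximum.\<close>

lemma saving_eq:
  assumes T: "T \<subseteq> {..<m}"
  shows "saving T v
    = (\<Sum>u\<in>color_of T v. int (w u)) - int (Max (insert 0 (w ` color_of T v)))"
proof -
  have fin: "finite T" using T finite_subset by blast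
  have "inj_on xs T" using inj T inj_on_subset by blast
  then have tot: "total T = (\<Sum>u\<in>xs ` T. int (w u))"
    by (simp add: total_def sum.reindex)
  have hv: "heaviest T = int (Max (insert 0 (w ` xs ` T)))"
    by (simp add: heaviest_def image_image)
  show ?thesis
  proof (cases "v \<in> xs ` {..<m}")
    case True
    then have "saving T v = total T - max (heaviest T) 0"
      by (simp add: saving_def rep_weight_def)
    also have "max (heaviest T) 0 = heaviest T" by (simp add: heaviest_def)
    finally show ?thesis using True by (simp add: tot hv color_of_def)
  next
    case False
    then have v: "v \<notin> xs ` T" using T by blast
    have "Max (insert 0 (w ` insert v (xs ` T))) = max (w v) (Max (insert 0 (w ` xs ` T)))"
      using fin by (simp add: insert_commute[of 0])
    then show ?thesis
      using False v fin
      by (simp add: saving_def rep_weight_def tot hv color_of_def max.commute of_nat_max)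
  qed
qed

text \<open>The recurrence unfolds into a choice of one set per vertex. Stated with a bound
  \<open>r\<close>, the \<open>Max\<close> becomes an existential, and the induction hypothesis
  applies to \<open>S - A\<close> and \<open>r - saving A l\<close>.\<close>

lemma le_opt_iff:
  assumes "finite S"
  shows "r \<le> opt l S \<longleftrightarrow> (\<exists>T. (\<forall>v<l. T v \<subseteq> S \<and> compatible (T v) v) \<and>
    disjoint_family_on T {..<l} \<and> r \<le> (\<Sum>v<l. saving (T v) v))"
  using assms
proof (induction l arbitrary: S r)
  case 0
  then show ?case by (simp add: disjoint_family_on_def)
next
  case (Suc l)
  \<comment> \<open>The empty set is always compatible, so the maximum is over a nonempty
    set.\<close>
  have "finite {T. T \<subseteq> S \<and> compatible T l}" "{} \<in> {T. T \<subseteq> S \<and> compatible T l}"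
    using Suc.prems by auto
  then have "r \<le> opt (Suc l) S \<longleftrightarrow>
      (\<exists>A\<in>{T. T \<subseteq> S \<and> compatible T l}. r \<le> opt l (S - A) + saving A l)"
    unfolding opt.simps by (subst Max_ge_iff) auto
  also have "\<dots> \<longleftrightarrow> (\<exists>A. A \<subseteq> S \<and> compatible A l \<and> r - saving A l \<le> opt l (S - A))"
    by (auto simp: algebra_simps)
  also have "\<dots> \<longleftrightarrow> (\<exists>A T. A \<subseteq> S \<and> compatible A l \<and>
      (\<forall>v<l. T v \<subseteq> S - A \<and> compatible (T v) v) \<and>
      disjoint_family_on T {..<l} \<and> r - saving A l \<le> (\<Sum>v<l. saving (T v) v))"
    using Suc by (simp only: finite_Diff) blast
  also have "\<dots> \<longleftrightarrow> (\<exists>T. (\<forall>v<Suc l. T v \<subseteq> S \<and> compatible (T v) v) \<and>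
    disjoint_family_on T {..<Suc l} \<and> r \<le> (\<Sum>v<Suc l. saving (T v) v))"
    (is "(\<exists>A T. ?P A T) \<longleftrightarrow> (\<exists>T. ?Q T)")
  proof
    assume "\<exists>A T. ?P A T"
    then obtain A T where P: "?P A T" by blast
    have "?Q (T(l := A))"
      using P by (auto simp: less_Suc_eq disjoint_family_on_def; blast)
    then show "\<exists>T. ?Q T" by blast
  next
    assume "\<exists>T. ?Q T"
    then obtain T where Q: "?Q T" by blast
    then have disj: "T v \<inter> T l = {}" if "v < l" for v
      using that by (auto simp: disjoint_family_on_def)
    have "T v \<subseteq> S - T l" if "v < l" for v
      using Q disj[OF that] that by (metis Diff_eq Int_subset_iff disjoint_eq_subset_Compl less_SucI)
    moreover have "disjoint_family_on T {..<l}"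
      using Q by (auto simp: disjoint_family_on_def)
    ultimately have "?P (T l) T" using Q by auto
    then show "\<exists>A T. ?P A T" by blast
  qed
  finally show ?case .
qed

text \<open>An optimal choice \<open>T\<close> yields the disjoint stable sets
  \<open>color_of (T v) v\<close>. Conversely, each color of a coloring is charged to one
  representative, and all other vertices receive the empty set.\<close>

theorem dual_weighted_coloring_iff_opt:
  "dual_weighted_coloring G w k \<longleftrightarrow> int k \<le> opt n {..<m}"
proof
  assume "int k \<le> opt n {..<m}"
  then obtain T where T: "\<And>v. v < n \<Longrightarrow> T v \<subseteq> {..<m}" "\<And>v. v < n \<Longrightarrow> compatible (T v) v"
    and disj: "disjoint_family_on T {..<n}" and k: "int k \<le> (\<Sum>v<n. saving (T v) v)"
    by (auto simp: le_opt_iff)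
  interpret pair_graph G by (rule graph)
  show "dual_weighted_coloring G w k"
  proof (rule dual_weighted_coloring_if_disjoint_stable[OF graph])
    show "disjoint_family_on (\<lambda>v. color_of (T v) v) {..<n}"
      unfolding disjoint_family_on_def
    proof (intro ballI impI)
      fix u v assume uv: "u \<in> {..<n}" "v \<in> {..<n}" "u \<noteq> v"
      then have "T u \<inter> T v = {}" using disj by (auto simp: disjoint_family_on_def)
      then have "xs ` T u \<inter> xs ` T v = {}"
        using inj_on_image_Int[OF inj, of "T u" "T v"] T(1) uv by auto
      moreover have "xs ` T u \<subseteq> xs ` {..<m}" "xs ` T v \<subseteq> xs ` {..<m}"
        using T(1) uv by blast+
      ultimately show "color_of (T u) u \<inter> color_of (T v) v = {}"
        using uv(3) unfolding color_of_def by (cases "u \<in> xs ` {..<m}"; cases "v \<in> xs ` {..<m}") auto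
    qed
    show "stable_set G (color_of (T v) v)" if "v \<in> {..<n}" for v
    proof -
      have v: "v < n" using that by simp
      have st: "stable_set G (xs ` T v)" "\<forall>i\<in>T v. (v, xs i) \<notin> parcs G"
        using T(2)[OF v] compatible_iff[OF T(1)[OF v]] by auto
      then have "\<forall>i\<in>T v. (xs i, v) \<notin> parcs G"
        using pair_sym_arcs by (auto simp: symmetric_def dest: symD)
      with st v show ?thesis
        using pair_no_loops by (fastforce simp: stable_set_def color_of_def verts)
    qed
    show "int k \<le> (\<Sum>v\<in>{..<n}. (\<Sum>u\<in>color_of (T v) v. int (w u))
        - int (Max (insert 0 (w ` color_of (T v) v))))"
      using k T(1) by (simp add: saving_eq)
  qed simp
next
  assume "dual_weighted_coloring G w k"
  then obtain \<C> l where C: "proper_coloring G l \<C>"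
    and k: "coloring_weight w \<C> + k \<le> (\<Sum>v\<in>pverts G. w v)"
    unfolding dual_weighted_coloring_iff[OF graph] by blast
  interpret pair_graph G by (rule graph)
  have part: "partition_on (pverts G) \<C>" and stable: "\<And>S. S \<in> \<C> \<Longrightarrow> stable_set G S"
    using C by (auto simp: proper_coloring_def)
  have ne: "S \<noteq> {}" if "S \<in> \<C>" for S using part that by (auto simp: partition_on_def)
  have eq: "S = S'" if "S \<in> \<C>" "S' \<in> \<C>" "u \<in> S" "u \<in> S'" for S S' u
    using part that by (auto simp: partition_on_def disjoint_def)
  have sub: "S \<subseteq> {..<n}" if "S \<in> \<C>" for S using part that verts by (auto simp: partition_on_def)
  have finS: "finite S" if "S \<in> \<C>" for S using sub[OF that] finite_subset by blast
  have finC: "finite \<C>" using finite_elements[OF pair_finite_verts part] .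
  \<comment> \<open>A vertex outside the modulator whenever the color has one, otherwise any of its
    vertices.\<close>
  define r where "r S = (SOME u. u \<in> S \<and> (S \<subseteq> xs ` {..<m} \<or> u \<notin> xs ` {..<m}))" for S
  have r: "r S \<in> S" "S \<subseteq> xs ` {..<m} \<or> r S \<notin> xs ` {..<m}" if "S \<in> \<C>" for S
  proof -
    have "\<exists>u. u \<in> S \<and> (S \<subseteq> xs ` {..<m} \<or> u \<notin> xs ` {..<m})"
      using ne[OF that] by blast
    from someI_ex[OF this] show "r S \<in> S" "S \<subseteq> xs ` {..<m} \<or> r S \<notin> xs ` {..<m}"
      unfolding r_def by blast+
  qed
  have injr: "inj_on r \<C>" by (rule inj_onI) (metis r(1) eq)
  define T where "T u = {i \<in> {..<m}. \<exists>S\<in>\<C>. r S = u \<and> xs i \<in> S}" for u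
  have Tr: "T (r S) = {i \<in> {..<m}. xs i \<in> S}" if "S \<in> \<C>" for S
    unfolding T_def using that injr by (auto simp: inj_on_def)
  have T0: "T u = {}" if "u \<notin> r ` \<C>" for u
    unfolding T_def using that by auto
  have col: "color_of (T (r S)) (r S) = S" if S: "S \<in> \<C>" for S
  proof -
    have img: "xs ` T (r S) = S \<inter> xs ` {..<m}" unfolding Tr[OF S] by auto
    have "u = r S" if "u \<in> S" "u \<notin> xs ` {..<m}" for u
    proof (rule ccontr)
      assume "u \<noteq> r S"
      \<comment> \<open>By the choice of \<open>r\<close>, also \<open>r S\<close> is an outer
        vertex; the clique then makes it adjacent to \<open>u\<close> inside a stable set.\<close>
      moreover have "r S \<notin> xs ` {..<m}" using r(2)[OF S] that by blast
      ultimately have "(u, r S) \<in> parcs G"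
        using clique[of u "r S"] that sub[OF S] r(1)[OF S] by auto
      then show False
        using stable[OF S] that(1) r(1)[OF S] by (auto simp: stable_set_def)
    qed
    then have "S \<subseteq> insert (r S) (xs ` {..<m})" by blast
    then show ?thesis
      using r[OF S] unfolding color_of_def img by (cases "r S \<in> xs ` {..<m}") auto
  qed
  have comp: "compatible (T u) u" for u
  proof (cases "u \<in> r ` \<C>")
    case True
    then obtain S where S: "S \<in> \<C>" "u = r S" by blast
    have "T u \<subseteq> {..<m}" by (auto simp: T_def)
    moreover have "\<And>i. i \<in> T u \<Longrightarrow> xs i \<in> S" using Tr[OF S(1)] S(2) by auto
    ultimately show ?thesis
      using stable[OF S(1)] r(1)[OF S(1)] S(2)
      by (subst compatible_iff) (auto simp: stable_set_def)
  qed (simp add: T0)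
  have disj: "disjoint_family_on T {..<n}"
    unfolding disjoint_family_on_def T_def using eq by blast
  \<comment> \<open>Vertices representing no color have \<open>T v = {}\<close> and save 0.\<close>
  have "(\<Sum>v<n. saving (T v) v) = (\<Sum>v\<in>r ` \<C>. saving (T v) v)"
    by (rule sum.mono_neutral_right) (use r(1) sub T0 in \<open>auto simp: subset_iff\<close>)
  also have "\<dots> = (\<Sum>S\<in>\<C>. saving (T (r S)) (r S))"
    by (subst sum.reindex[OF injr]) simp
  also have "\<dots> = (\<Sum>S\<in>\<C>. int (\<Sum>v\<in>S. w v) - int (color_weight w S))"
  proof (rule sum.cong[OF refl])
    fix S assume S: "S \<in> \<C>"
    have "T (r S) \<subseteq> {..<m}" by (auto simp: T_def)
    then show "saving (T (r S)) (r S) = int (\<Sum>v\<in>S. w v) - int (color_weight w S)"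
      using ne[OF S] finS[OF S] by (simp add: saving_eq col[OF S] color_weight_def)
  qed
  also have "\<dots> = int (\<Sum>v\<in>pverts G. w v) - int (coloring_weight w \<C>)"
  proof -
    have "(\<Sum>v\<in>pverts G. w v) = (\<Sum>S\<in>\<C>. \<Sum>v\<in>S. w v)"
      using sum.Union_disjoint_sets[of \<C> w] part finS
      by (auto simp: partition_on_def disjoint_def)
    then show ?thesis by (simp add: sum_subtractf coloring_weight_def)
  qed
  finally have "int k \<le> (\<Sum>v<n. saving (T v) v)" using k by linarith
  moreover have "T v \<subseteq> {..<m}" for v by (auto simp: T_def)
  ultimately show "int k \<le> opt n {..<m}"
    using comp disj by (auto simp: le_opt_iff)
qed

end

section \<open>Tables indexed by sets\<close>

lemma set_encode_less: "S \<subseteq> {..<i} \<Longrightarrow> set_encode S < 2 ^ i"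
proof (induction i arbitrary: S)
  case 0
  then show ?case by simp
next
  case (Suc i)
  have sub: "S - {i} \<subseteq> {..<i}" using Suc.prems by (auto simp: less_Suc_eq)
  have fin: "finite (S - {i})" using sub finite_subset by blast
  from Suc.IH[OF sub] have less: "set_encode (S - {i}) < 2 ^ i" .
  show ?case
  proof (cases "i \<in> S")
    case True
    have "set_encode (insert i (S - {i})) = 2 ^ i + set_encode (S - {i})"
      by (rule set_encode_insert) (use fin in auto)
    then show ?thesis using less True by (simp add: insert_absorb)
  next
    case False
    then show ?thesis using less by simp
  qed
qed

lemma set_encode_lessThan: "set_encode {..<i} = 2 ^ i - 1"
  by (simp add: set_encode_def lessThan_atLeast0 sum_power2)

abbreviation code :: "nat set \<Rightarrow> int" where
  "code S \<equiv> int (set_encode S)"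

lemma code_less: "S \<subseteq> {..<i} \<Longrightarrow> code S < 2 ^ i"
  using set_encode_less[of S i] by (metis of_nat_less_iff of_nat_numeral of_nat_power)

text \<open>The step of each doubling loop: an entry of the enlarged table is either an old one or
  sits \<open>2 ^ i\<close> above an old one.\<close>

lemma subset_lessThan_Suc_cases:
  assumes "S \<subseteq> {..<Suc i}"
  obtains "S \<subseteq> {..<i}" | S' where "S' \<subseteq> {..<i}" "S = insert i S'" "code S = 2 ^ i + code S'"
proof (cases "i \<in> S")
  case True
  define S' where "S' = S - {i}"
  have S': "S' \<subseteq> {..<i}" using assms by (auto simp: S'_def less_Suc_eq)
  have ins: "S = insert i S'" using True by (auto simp: S'_def)
  have "set_encode S = 2 ^ i + set_encode S'"
    unfolding ins by (rule set_encode_insert) (use S' in \<open>auto intro: finite_subset\<close>)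
  then have "code S = 2 ^ i + code S'" by simp
  with S' ins that(2) show thesis by blast
next
  case False
  with assms have "S \<subseteq> {..<i}" by (auto simp: less_Suc_eq)
  then show thesis by (rule that(1))
qed

text \<open>Lets the rows of length \<open>2 ^ i\<close> and \<open>3 ^ i\<close> all be charged to
  the common unit \<open>3 ^ m\<close>.\<close>

lemma power_le_3_power: "a \<le> 3 \<Longrightarrow> i \<le> m \<Longrightarrow> a ^ i \<le> (3 :: nat) ^ m"
  by (meson one_le_numeral order_trans power_increasing power_mono zero_le)


section \<open>The conflict table of a vertex\<close>

text \<open>Tables over the subsets of \<open>{..<m}\<close> are indexed by \<^const>\<open>set_encode\<close> and grow by doubling: the entry
  of \<open>insert i S\<close>, at position \<open>2 ^ i + code S\<close>, is computed from the entry of \<open>S\<close>. The array \<open>X\<close> holds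
  the modulator, \<open>m\<close> its size, and \<open>row[u]\<close> is \<open>u * n\<close>, as there is no multiplication.\<close>

definition conflict_row :: com where
  "conflict_row = For ''f'' ''q''
     (Assign ''cm'' (Plus (Var ''q'') (Var ''f'')) (Plus (Cell ''cm'' (Var ''f'')) (Var ''a'')))"

definition conflict_step :: com where
  "conflict_step =
     Seq (SetVar ''a'' (Cell ''adj'' (Plus (Cell ''row'' (Var ''u'')) (Cell ''X'' (Var ''e'')))))
    (Seq conflict_row (SetVar ''q'' (Plus (Var ''q'') (Var ''q''))))"

definition conflict_table :: com where
  "conflict_table =
     Seq (Seq (SetVar ''cm'' (Const 0)) (SetVar ''q'' (Const 1))) (For ''e'' ''m'' conflict_step)"

lemma mods_conflict_row [simp]: "mods conflict_row = {''f'', ''cm''}"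
  by (simp add: conflict_row_def)

lemma mods_conflict_step [simp]: "mods conflict_step = {''a'', ''f'', ''cm'', ''q''}"
  by (auto simp: conflict_step_def)

lemma mods_conflict_table [simp]: "mods conflict_table = {''e'', ''a'', ''f'', ''cm'', ''q''}"
  by (auto simp: conflict_table_def)

text \<open>All reads of \<open>cm\<close> are below position \<open>2 ^ i\<close> and all writes at
  or above it, so the source entries stay intact throughout the loop.\<close>

lemma runs_conflict_row:
  assumes q: "s ''q'' 0 = 2 ^ i" and tab: "\<And>S. S \<subseteq> {..<i} \<Longrightarrow> s ''cm'' (code S) = F S"
    and a: "s ''a'' 0 = a" and i: "i \<le> m"
  shows "runs conflict_row s (33 * 3 ^ m)
    (\<lambda>s'. \<forall>S\<subseteq>{..<i}. s' ''cm'' (code S) = F S \<and> s' ''cm'' (2 ^ i + code S) = F S + a)"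
proof -
  let ?Inv = "\<lambda>j s'. \<forall>S\<subseteq>{..<i}. s' ''cm'' (code S) = F S \<and>
    (set_encode S < j \<longrightarrow> s' ''cm'' (2 ^ i + code S) = F S + a)"
  have "runs conflict_row s (33 * 3 ^ m) (?Inv (2 ^ i))"
    unfolding conflict_row_def
  proof (rule runs_For[where Inv = ?Inv and B = 12])
    show "s ''q'' 0 = int (2 ^ i)" using q by simp
    show "2 ^ i * (12 + 12) + 9 \<le> 33 * (3 ^ m :: nat)"
      using loop_cost[of 12 12 1 "2 ^ i" "3 ^ m" 33] power_le_3_power[OF _ i, of 2] by simp
    fix j s'
    assume f: "s' ''f'' 0 = int j" and inv: "?Inv j s'"
      and fr: "\<forall>x. x \<notin> insert ''f'' (mods (Assign ''cm'' (Plus (Var ''q'') (Var ''f''))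
        (Plus (Cell ''cm'' (Var ''f'')) (Var ''a'')))) \<longrightarrow> s' x = s x"
    have eqs: "s' ''q'' 0 = 2 ^ i" "s' ''a'' 0 = a" using fr q a by simp_all
    show "runs (Assign ''cm'' (Plus (Var ''q'') (Var ''f'')) (Plus (Cell ''cm'' (Var ''f'')) (Var ''a'')))
      s' 12 (?Inv (Suc j))"
    proof (rule runs_loop_free)
      show "?Inv (Suc j) (loop_free_result (Assign ''cm'' (Plus (Var ''q'') (Var ''f''))
          (Plus (Cell ''cm'' (Var ''f'')) (Var ''a''))) s')"
        using inv by (auto simp: eqs f less_Suc_eq dest: code_less)
    qed simp_all
  qed (use tab in auto)
  then show ?thesis
    by (rule runs_mono) (use set_encode_less in auto)
qed

context clique_modulator
begin

lemma m_le_n: "m \<le> n"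
  using card_inj_on_le[OF inj, of "{..<n}"] xs_less by auto

lemma conflicts_insert:
  "S \<subseteq> {..<i} \<Longrightarrow> conflicts v (insert i S) = conflicts v S + (if (v, xs i) \<in> parcs G then 1 else 0)"
  unfolding conflicts_def by (subst sum.insert) (auto intro: finite_subset)

lemma total_insert: "S \<subseteq> {..<i} \<Longrightarrow> total (insert i S) = total S + int (w (xs i))"
  unfolding total_def by (subst sum.insert) (auto intro: finite_subset)

lemma heaviest_insert: "S \<subseteq> {..<i} \<Longrightarrow> heaviest (insert i S) = max (heaviest S) (int (w (xs i)))"
proof -
  assume "S \<subseteq> {..<i}"
  then have "finite S" using finite_subset by blast
  then show ?thesis
    by (simp add: heaviest_def insert_commute[of 0] max.commute of_nat_max)
qed

text \<open>The new index exceeds all of \<open>S\<close>, hence it is invisible to the counts of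
  the old indices, which look only at smaller ones.\<close>

lemma inner_conflicts_insert:
  assumes "S \<subseteq> {..<i}"
  shows "inner_conflicts (insert i S) = inner_conflicts S + conflicts (xs i) S"
proof -
  have fin: "finite S" "i \<notin> S" using assms finite_subset by auto
  have "inner_conflicts (insert i S)
      = conflicts (xs i) (insert i S \<inter> {..<i}) + (\<Sum>j\<in>S. conflicts (xs j) (insert i S \<inter> {..<j}))"
    unfolding inner_conflicts_def using fin by simp
  also have "insert i S \<inter> {..<i} = S" using assms by auto
  also have "(\<Sum>j\<in>S. conflicts (xs j) (insert i S \<inter> {..<j})) = inner_conflicts S"
    unfolding inner_conflicts_def
  proof (rule sum.cong[OF refl])
    fix j assume "j \<in> S"
    then have "insert i S \<inter> {..<j} = S \<inter> {..<j}" using assms by auto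
    then show "conflicts (xs j) (insert i S \<inter> {..<j}) = conflicts (xs j) (S \<inter> {..<j})" by simp
  qed
  finally show ?thesis by simp
qed

text \<open>What the phases after the matching rely on. It mentions only arrays that none of them
  modifies, so \<open>input_cong\<close> and the frame conditions carry it through every loop.
  Matrix entries are addressed through \<open>row\<close>, exactly as the programs do.\<close>

definition input :: "state \<Rightarrow> bool" where
  "input s \<longleftrightarrow> s ''n'' 0 = int n \<and> s ''m'' 0 = int m \<and> (\<forall>i<m. s ''X'' (int i) = int (xs i)) \<and>
     (\<forall>u<n. \<forall>v<n. s ''adj'' (s ''row'' (int u) + int v) = (if (u, v) \<in> parcs G then 1 else 0)) \<and>
     (\<forall>v<n. s ''w'' (int v) = int (w v) \<and> s ''wp'' (int v) = rep_weight v)"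

lemma input_cong:
  "\<lbrakk>input s; s' ''n'' = s ''n''; s' ''m'' = s ''m''; s' ''X'' = s ''X''; s' ''adj'' = s ''adj'';
    s' ''row'' = s ''row''; s' ''w'' = s ''w''; s' ''wp'' = s ''wp''\<rbrakk> \<Longrightarrow> input s'"
  unfolding input_def by simp

lemma runs_conflict_step:
  assumes inp: "input s" and u: "s ''u'' 0 = int u" "u < n" and e: "s ''e'' 0 = int i" "i < m"
    and q: "s ''q'' 0 = 2 ^ i" and tab: "\<forall>S\<subseteq>{..<i}. s ''cm'' (code S) = conflicts u S"
  shows "runs conflict_step s (50 * 3 ^ m)
    (\<lambda>s'. s' ''q'' 0 = 2 ^ Suc i \<and> (\<forall>S\<subseteq>{..<Suc i}. s' ''cm'' (code S) = conflicts u S))"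
proof -
  let ?a = "if (u, xs i) \<in> parcs G then 1 else 0 :: int"
  have a: "s ''adj'' (s ''row'' (int u) + s ''X'' (int i)) = ?a"
    using inp u e xs_less by (simp add: input_def)
  show ?thesis
    unfolding conflict_step_def
  proof (rule runs_Seq[where ?T1.0 = 10 and ?T2.0 = "40 * 3 ^ m"])
    let ?asg = "SetVar ''a'' (Cell ''adj'' (Plus (Cell ''row'' (Var ''u'')) (Cell ''X'' (Var ''e''))))"
    show "runs ?asg s 10 (\<lambda>s'. s' ''a'' 0 = ?a)"
      by (rule runs_loop_free) (simp_all add: u e a)
    fix s1 assume a1: "s1 ''a'' 0 = ?a" and "\<forall>x. x \<notin> mods ?asg \<longrightarrow> s1 x = s x"
    then have eqs: "s1 ''q'' = s ''q''" "s1 ''cm'' = s ''cm''" by simp_all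
    show "runs (Seq conflict_row (SetVar ''q'' (Plus (Var ''q'') (Var ''q'')))) s1 (40 * 3 ^ m)
      (\<lambda>s'. s' ''q'' 0 = 2 ^ Suc i \<and> (\<forall>S\<subseteq>{..<Suc i}. s' ''cm'' (code S) = conflicts u S))"
    proof (rule runs_Seq[where ?T2.0 = 7, OF runs_conflict_row[where m = m]])
      fix s2 assume 2: "\<forall>S\<subseteq>{..<i}. s2 ''cm'' (code S) = conflicts u S
          \<and> s2 ''cm'' (2 ^ i + code S) = conflicts u S + ?a"
        and "\<forall>x. x \<notin> mods conflict_row \<longrightarrow> s2 x = s1 x"
      then have q2: "s2 ''q'' 0 = 2 ^ i" using q eqs by simp
      have "s2 ''cm'' (code S) = conflicts u S" if "S \<subseteq> {..<Suc i}" for S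
        using that by (cases rule: subset_lessThan_Suc_cases) (use 2 in \<open>simp_all add: conflicts_insert\<close>)
      then show "runs (SetVar ''q'' (Plus (Var ''q'') (Var ''q''))) s2 7
        (\<lambda>s'. s' ''q'' 0 = 2 ^ Suc i \<and> (\<forall>S\<subseteq>{..<Suc i}. s' ''cm'' (code S) = conflicts u S))"
        by (intro runs_loop_free) (simp_all add: q2)
    qed (use q tab eqs a1 e in \<open>auto intro: add_cost\<close>)
  qed (rule add_cost; simp)
qed

lemma runs_conflict_table:
  assumes inp: "input s" and u: "s ''u'' 0 = int u" "u < n"
  shows "runs conflict_table s (100 * ((n + 1) * 3 ^ m))
    (\<lambda>s'. \<forall>S\<subseteq>{..<m}. s' ''cm'' (code S) = conflicts u S)"
  unfolding conflict_table_def
proof (rule runs_Seq[where ?T1.0 = 6 and ?T2.0 = "71 * ((n + 1) * 3 ^ m)"])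
  let ?init = "Seq (SetVar ''cm'' (Const 0)) (SetVar ''q'' (Const 1))"
  show "runs ?init s 6 (\<lambda>s'. s' ''cm'' 0 = 0 \<and> s' ''q'' 0 = 1)"
    by (rule runs_loop_free) simp_all
  fix s1 assume 1: "s1 ''cm'' 0 = 0 \<and> s1 ''q'' 0 = 1"
    and fr1: "\<forall>x. x \<notin> mods ?init \<longrightarrow> s1 x = s x"
  let ?Inv = "\<lambda>i s'. s' ''q'' 0 = 2 ^ i \<and> (\<forall>S\<subseteq>{..<i}. s' ''cm'' (code S) = conflicts u S)"
  have "runs (For ''e'' ''m'' conflict_step) s1 (71 * ((n + 1) * 3 ^ m)) (?Inv m)"
  proof (rule runs_For[where Inv = ?Inv and B = "50 * 3 ^ m"])
    show "s1 ''m'' 0 = int m" using inp fr1 by (simp add: input_def)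
    show "m * (50 * 3 ^ m + 12) + 9 \<le> 71 * ((n + 1) * 3 ^ m)"
      by (rule loop_cost[where a = 50]) (use m_le_n in auto)
    show "?Inv 0 s1" using 1 by (simp add: conflicts_def)
    fix j s' assume j: "j < m" "s' ''e'' 0 = int j" and inv: "?Inv j s'"
      and fr: "\<forall>x. x \<notin> insert ''e'' (mods conflict_step) \<longrightarrow> s' x = s1 x"
    have "input s'" by (rule input_cong[OF inp]) (simp_all add: fr fr1)
    moreover have "s' ''u'' 0 = int u" using fr fr1 u by simp
    ultimately show "runs conflict_step s' (50 * 3 ^ m) (?Inv (Suc j))"
      using runs_conflict_step u(2) j inv by blast
  qed auto
  then show "runs (For ''e'' ''m'' conflict_step) s1 (71 * ((n + 1) * 3 ^ m))
    (\<lambda>s'. \<forall>S\<subseteq>{..<m}. s' ''cm'' (code S) = conflicts u S)"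
    by (rule runs_mono) auto
qed (rule add_cost; simp)

end

section \<open>Tables of totals, conflicts and maxima\<close>

text \<open>The arrays \<open>sm\<close>, \<open>bad\<close> and \<open>mx\<close> tabulate the total weight, the number of inner conflicts and the
  largest weight of a set; \<open>p\<close> is the current table length.\<close>

definition set_row_body :: com where
  "set_row_body =
     Seq (Assign ''sm'' (Plus (Var ''p'') (Var ''j'')) (Plus (Cell ''sm'' (Var ''j'')) (Var ''wv'')))
    (Seq (Assign ''bad'' (Plus (Var ''p'') (Var ''j''))
           (Plus (Cell ''bad'' (Var ''j'')) (Cell ''cm'' (Var ''j''))))
         (If (Less (Cell ''mx'' (Var ''j'')) (Var ''wv''))
           (Assign ''mx'' (Plus (Var ''p'') (Var ''j'')) (Var ''wv''))
           (Assign ''mx'' (Plus (Var ''p'') (Var ''j'')) (Cell ''mx'' (Var ''j'')))))"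

definition set_row :: com where
  "set_row = For ''j'' ''p'' set_row_body"

definition set_step :: com where
  "set_step =
     Seq (SetVar ''u'' (Cell ''X'' (Var ''i'')))
    (Seq conflict_table
    (Seq (SetVar ''wv'' (Cell ''w'' (Var ''u'')))
    (Seq set_row (SetVar ''p'' (Plus (Var ''p'') (Var ''p''))))))"

definition set_init :: com where
  "set_init = Seq (SetVar ''sm'' (Const 0)) (Seq (SetVar ''bad'' (Const 0))
    (Seq (SetVar ''mx'' (Const 0)) (SetVar ''p'' (Const 1))))"

definition set_tables :: com where
  "set_tables = Seq set_init (For ''i'' ''m'' set_step)"

lemma mods_set_row_body [simp]: "mods set_row_body = {''sm'', ''bad'', ''mx''}"
  by (auto simp: set_row_body_def)

lemma mods_set_row [simp]: "mods set_row = {''j'', ''sm'', ''bad'', ''mx''}"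
  by (auto simp: set_row_def)

lemma mods_set_step [simp]: "mods set_step =
    {''u'', ''e'', ''a'', ''f'', ''cm'', ''q'', ''wv'', ''j'', ''sm'', ''bad'', ''mx'', ''p''}"
  by (auto simp: set_step_def)

lemma mods_set_init [simp]: "mods set_init = {''sm'', ''bad'', ''mx'', ''p''}"
  by (auto simp: set_init_def)

lemma mods_set_tables [simp]: "mods set_tables =
    {''i'', ''u'', ''e'', ''a'', ''f'', ''cm'', ''q'', ''wv'', ''j'', ''sm'', ''bad'', ''mx'', ''p''}"
  by (auto simp: set_tables_def)

lemma runs_set_row:
  assumes p: "s ''p'' 0 = 2 ^ i"
    and tab: "\<And>S. S \<subseteq> {..<i} \<Longrightarrow> s ''sm'' (code S) = F S"
      "\<And>S. S \<subseteq> {..<i} \<Longrightarrow> s ''bad'' (code S) = H S"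
      "\<And>S. S \<subseteq> {..<i} \<Longrightarrow> s ''mx'' (code S) = M S"
      "\<And>S. S \<subseteq> {..<i} \<Longrightarrow> s ''cm'' (code S) = R S"
    and a: "s ''wv'' 0 = a" and i: "i \<le> m"
  shows "runs set_row s (62 * 3 ^ m) (\<lambda>s'. \<forall>S\<subseteq>{..<i}.
    s' ''sm'' (code S) = F S \<and> s' ''sm'' (2 ^ i + code S) = F S + a \<and>
    s' ''bad'' (code S) = H S \<and> s' ''bad'' (2 ^ i + code S) = H S + R S \<and>
    s' ''mx'' (code S) = M S \<and> s' ''mx'' (2 ^ i + code S) = max (M S) a)"
proof -
  let ?Inv = "\<lambda>j s'. \<forall>S\<subseteq>{..<i}.
    s' ''sm'' (code S) = F S \<and> s' ''bad'' (code S) = H S \<and> s' ''mx'' (code S) = M S \<and>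
    (set_encode S < j \<longrightarrow> s' ''sm'' (2 ^ i + code S) = F S + a \<and>
      s' ''bad'' (2 ^ i + code S) = H S + R S \<and> s' ''mx'' (2 ^ i + code S) = max (M S) a)"
  have "runs set_row s (62 * 3 ^ m) (?Inv (2 ^ i))"
    unfolding set_row_def
  proof (rule runs_For[where Inv = ?Inv and B = 41])
    show "s ''p'' 0 = int (2 ^ i)" using p by simp
    show "2 ^ i * (41 + 12) + 9 \<le> 62 * (3 ^ m :: nat)"
      using loop_cost[of 41 41 1 "2 ^ i" "3 ^ m" 62] power_le_3_power[OF _ i, of 2] by simp
    fix j s'
    assume j: "s' ''j'' 0 = int j" and inv: "?Inv j s'"
      and fr: "\<forall>x. x \<notin> insert ''j'' (mods set_row_body) \<longrightarrow> s' x = s x"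
    have eqs: "s' ''p'' 0 = 2 ^ i" "s' ''wv'' 0 = a" "s' ''cm'' = s ''cm''" using fr p a by simp_all
    show "runs set_row_body s' 41 (?Inv (Suc j))"
    proof (rule runs_loop_free)
      show "?Inv (Suc j) (loop_free_result set_row_body s')"
      proof (intro allI impI)
        fix S assume S: "S \<subseteq> {..<i}"
        note facts = inv[rule_format, OF S] tab(4)[OF S]
        \<comment> \<open>The write goes to the upper half and misses all old entries.\<close>
        have ne: "code S \<noteq> 2 ^ i + int j" using code_less[OF S] by linarith
        show "loop_free_result set_row_body s' ''sm'' (code S) = F S \<and>
          loop_free_result set_row_body s' ''bad'' (code S) = H S \<and>
          loop_free_result set_row_body s' ''mx'' (code S) = M S \<and>
          (set_encode S < Suc j \<longrightarrow>
            loop_free_result set_row_body s' ''sm'' (2 ^ i + code S) = F S + a \<and>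
            loop_free_result set_row_body s' ''bad'' (2 ^ i + code S) = H S + R S \<and>
            loop_free_result set_row_body s' ''mx'' (2 ^ i + code S) = max (M S) a)"
          using facts by (auto simp: set_row_body_def eqs j less_Suc_eq ne)
      qed
    qed (simp_all add: set_row_body_def)
  qed (use tab in auto)
  then show ?thesis
    by (rule runs_mono) (use set_encode_less in auto)
qed


section \<open>The table of pairs of disjoint sets\<close>

text \<open>The arrays \<open>B\<close> and \<open>C\<close> list the \<open>3 ^ m\<close> pairs of disjoint sets, \<open>r\<close> is the length of the list, and \<open>z\<close> is
  the code of the next index: it is added to neither, to the first or to the second set.\<close>

definition pair_row_body :: com where
  "pair_row_body =
     Seq (Assign ''B'' (Plus (Var ''r'') (Var ''j'')) (Plus (Cell ''B'' (Var ''j'')) (Var ''z'')))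
    (Seq (Assign ''C'' (Plus (Var ''r'') (Var ''j'')) (Cell ''C'' (Var ''j'')))
    (Seq (Assign ''B'' (Plus (Plus (Var ''r'') (Var ''r'')) (Var ''j'')) (Cell ''B'' (Var ''j'')))
         (Assign ''C'' (Plus (Plus (Var ''r'') (Var ''r'')) (Var ''j''))
           (Plus (Cell ''C'' (Var ''j'')) (Var ''z'')))))"

definition pair_row :: com where
  "pair_row = For ''j'' ''r'' pair_row_body"

definition pair_step :: com where
  "pair_step = Seq pair_row
    (Seq (SetVar ''z'' (Plus (Var ''z'') (Var ''z'')))
         (SetVar ''r'' (Plus (Plus (Var ''r'') (Var ''r'')) (Var ''r''))))"

definition pair_init :: com where
  "pair_init = Seq (SetVar ''B'' (Const 0)) (Seq (SetVar ''C'' (Const 0))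
    (Seq (SetVar ''z'' (Const 1)) (SetVar ''r'' (Const 1))))"

definition pair_tables :: com where
  "pair_tables = Seq pair_init (For ''i'' ''m'' pair_step)"

lemma mods_pair_row_body [simp]: "mods pair_row_body = {''B'', ''C''}"
  by (auto simp: pair_row_body_def)

lemma mods_pair_row [simp]: "mods pair_row = {''j'', ''B'', ''C''}"
  by (auto simp: pair_row_def)

lemma mods_pair_step [simp]: "mods pair_step = {''j'', ''B'', ''C'', ''z'', ''r''}"
  by (auto simp: pair_step_def)

lemma mods_pair_init [simp]: "mods pair_init = {''B'', ''C'', ''z'', ''r''}"
  by (auto simp: pair_init_def)

lemma mods_pair_tables [simp]: "mods pair_tables = {''i'', ''j'', ''B'', ''C'', ''z'', ''r''}"
  by (auto simp: pair_tables_def)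

text \<open>In the recurrence, \<open>b\<close> is the chosen set \<open>T\<close>, \<open>c\<close>
  is \<open>S - T\<close>, and their union is \<open>S\<close>.\<close>

definition disjoint_pair :: "nat \<Rightarrow> nat set \<Rightarrow> nat set \<Rightarrow> bool" where
  "disjoint_pair i b c \<longleftrightarrow> b \<subseteq> {..<i} \<and> c \<subseteq> {..<i} \<and> b \<inter> c = {}"

text \<open>Only the contents of the list matter, not its order: that every position holds a
  disjoint pair makes each relaxation legitimate, and that every disjoint pair occurs makes the
  maximum complete.\<close>

definition pairs_listed :: "nat \<Rightarrow> state \<Rightarrow> bool" where
  "pairs_listed i s \<longleftrightarrow> s ''r'' 0 = 3 ^ i \<and>
     (\<forall>j<3 ^ i. \<exists>b c. disjoint_pair i b c \<and> s ''B'' (int j) = code b \<and> s ''C'' (int j) = code c) \<and>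
     (\<forall>b c. disjoint_pair i b c \<longrightarrow>
        (\<exists>j<3 ^ i. s ''B'' (int j) = code b \<and> s ''C'' (int j) = code c))"

lemma runs_pair_row:
  assumes r: "s ''r'' 0 = int l" and z: "s ''z'' 0 = z" and l: "l \<le> 3 ^ m"
  shows "runs pair_row s (69 * 3 ^ m) (\<lambda>s'. \<forall>j<l.
    s' ''B'' (int j) = s ''B'' (int j) \<and> s' ''C'' (int j) = s ''C'' (int j) \<and>
    s' ''B'' (int (l + j)) = s ''B'' (int j) + z \<and> s' ''C'' (int (l + j)) = s ''C'' (int j) \<and>
    s' ''B'' (int (l + l + j)) = s ''B'' (int j) \<and> s' ''C'' (int (l + l + j)) = s ''C'' (int j) + z)"
proof -
  let ?Inv = "\<lambda>t s'. \<forall>j<l.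
    s' ''B'' (int j) = s ''B'' (int j) \<and> s' ''C'' (int j) = s ''C'' (int j) \<and> (j < t \<longrightarrow>
    s' ''B'' (int (l + j)) = s ''B'' (int j) + z \<and> s' ''C'' (int (l + j)) = s ''C'' (int j) \<and>
    s' ''B'' (int (l + l + j)) = s ''B'' (int j) \<and> s' ''C'' (int (l + l + j)) = s ''C'' (int j) + z)"
  have "runs pair_row s (69 * 3 ^ m) (?Inv l)"
    unfolding pair_row_def
  proof (rule runs_For[where Inv = ?Inv and B = 48])
    show "l * (48 + 12) + 9 \<le> 69 * (3 ^ m :: nat)"
      using loop_cost[of 48 48 1 l "3 ^ m" 69] l by simp
    fix t s'
    assume t: "t < l" "s' ''j'' 0 = int t" and inv: "?Inv t s'"
      and fr: "\<forall>x. x \<notin> insert ''j'' (mods pair_row_body) \<longrightarrow> s' x = s x"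
    have eqs: "s' ''r'' 0 = int l" "s' ''z'' 0 = z" using fr r z by simp_all
    show "runs pair_row_body s' 48 (?Inv (Suc t))"
      by (rule runs_loop_free)
        (use inv t in \<open>auto simp: pair_row_body_def eqs less_Suc_eq\<close>)
  qed (use r in auto)
  then show ?thesis by (rule runs_mono) auto
qed

lemma code_insert: "S \<subseteq> {..<i} \<Longrightarrow> code (insert i S) = 2 ^ i + code S"
  by (subst set_encode_insert) (auto intro: finite_subset)

text \<open>The new list consists of three blocks of length \<open>3 ^ i\<close>, in which index
  \<open>i\<close> belongs to neither set, to the first, or to the second. Deleting \<open>i\<close>
  from a pair leads back to an entry of the old list.\<close>

lemma pairs_listed_Suc:
  assumes pairs: "pairs_listed i s"
    and row: "\<forall>j<3 ^ i.
      s' ''B'' (int j) = s ''B'' (int j) \<and> s' ''C'' (int j) = s ''C'' (int j) \<and>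
      s' ''B'' (int (3 ^ i + j)) = s ''B'' (int j) + 2 ^ i \<and>
      s' ''C'' (int (3 ^ i + j)) = s ''C'' (int j) \<and>
      s' ''B'' (int (3 ^ i + 3 ^ i + j)) = s ''B'' (int j) \<and>
      s' ''C'' (int (3 ^ i + 3 ^ i + j)) = s ''C'' (int j) + 2 ^ i"
    and r: "s' ''r'' 0 = 3 ^ Suc i"
  shows "pairs_listed (Suc i) s'"
proof -
  let ?l = "3 ^ i :: nat"
  let ?at = "\<lambda>s j b c. s ''B'' (int j) = code b \<and> s ''C'' (int j) = code c"
  have at: "?at s' j b c" "?at s' (?l + j) (insert i b) c" "?at s' (?l + ?l + j) b (insert i c)"
    if "j < ?l" "disjoint_pair i b c" "?at s j b c" for j b c
    using row[rule_format, OF that(1)] that(2,3)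
    by (simp_all add: disjoint_pair_def code_insert del: set_encode_insert)
  have ext: "disjoint_pair (Suc i) b c" "disjoint_pair (Suc i) (insert i b) c"
    "disjoint_pair (Suc i) b (insert i c)" if "disjoint_pair i b c" for b c
    using that by (auto simp: disjoint_pair_def less_Suc_eq)
  have "\<exists>b c. disjoint_pair (Suc i) b c \<and> ?at s' j b c" if "j < 3 ^ Suc i" for j
  proof -
    have "j < ?l + ?l + ?l" using that by simp
    then have "j < ?l \<or> (j = ?l + (j - ?l) \<and> j - ?l < ?l) \<or>
        (j = ?l + ?l + (j - (?l + ?l)) \<and> j - (?l + ?l) < ?l)" by linarith
    then consider "j < ?l" | j' where "j = ?l + j'" "j' < ?l"
      | j' where "j = ?l + ?l + j'" "j' < ?l"
      by blast
    then show ?thesis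
    proof cases
      case 1
      then obtain b c where "disjoint_pair i b c" "?at s j b c"
        using pairs unfolding pairs_listed_def by blast
      then show ?thesis using at(1)[OF 1] ext by blast
    next
      case 2
      then obtain b c where "disjoint_pair i b c" "?at s j' b c"
        using pairs unfolding pairs_listed_def by blast
      then show ?thesis using at(2)[OF 2(2)] ext unfolding 2(1) by blast
    next
      case 3
      then obtain b c where "disjoint_pair i b c" "?at s j' b c"
        using pairs unfolding pairs_listed_def by blast
      then show ?thesis using at(3)[OF 3(2)] ext unfolding 3(1) by blast
    qed
  qed
  moreover have "\<exists>j<3 ^ Suc i. ?at s' j b c" if bc: "disjoint_pair (Suc i) b c" for b c
  proof -
    let ?b = "b - {i}" and ?c = "c - {i}"
    have "disjoint_pair i ?b ?c" using bc by (auto simp: disjoint_pair_def less_Suc_eq)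
    then obtain j where j: "j < ?l" "?at s j ?b ?c"
      using pairs unfolding pairs_listed_def by blast
    note at' = at[OF j(1) \<open>disjoint_pair i ?b ?c\<close> j(2)]
    consider "b = ?b" "c = ?c" | "b = insert i ?b" "c = ?c" | "b = ?b" "c = insert i ?c"
      using bc by (cases "i \<in> b"; cases "i \<in> c") (auto simp: disjoint_pair_def)
    then show ?thesis
    proof cases
      case 1
      then have "?at s' j b c" using at'(1) by metis
      moreover have "j < 3 ^ Suc i" using j(1) by simp
      ultimately show ?thesis by blast
    next
      case 2
      then have "?at s' (?l + j) b c" using at'(2) by metis
      moreover have "?l + j < 3 ^ Suc i" using j(1) by simp
      ultimately show ?thesis by blast
    next
      case 3
      then have "?at s' (?l + ?l + j) b c" using at'(3) by metis
      moreover have "?l + ?l + j < 3 ^ Suc i" using j(1) by simp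
      ultimately show ?thesis by blast
    qed
  qed
  ultimately show ?thesis using r unfolding pairs_listed_def by blast
qed

lemma runs_pair_step:
  assumes pairs: "pairs_listed i s" and z: "s ''z'' 0 = 2 ^ i" and i: "i \<le> m"
  shows "runs pair_step s (86 * 3 ^ m) (\<lambda>s'. pairs_listed (Suc i) s' \<and> s' ''z'' 0 = 2 ^ Suc i)"
  unfolding pair_step_def
proof (rule runs_Seq[where ?T2.0 = 17, OF runs_pair_row[where m = m and l = "3 ^ i" and z = "2 ^ i"]])
  show "s ''r'' 0 = int (3 ^ i)" using pairs by (simp add: pairs_listed_def)
  show "(3 :: nat) ^ i \<le> 3 ^ m" using i by (rule power_le_3_power[OF order_refl])
  fix s1 assume row: "\<forall>j<3 ^ i.
      s1 ''B'' (int j) = s ''B'' (int j) \<and> s1 ''C'' (int j) = s ''C'' (int j) \<and>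
      s1 ''B'' (int (3 ^ i + j)) = s ''B'' (int j) + 2 ^ i \<and>
      s1 ''C'' (int (3 ^ i + j)) = s ''C'' (int j) \<and>
      s1 ''B'' (int (3 ^ i + 3 ^ i + j)) = s ''B'' (int j) \<and>
      s1 ''C'' (int (3 ^ i + 3 ^ i + j)) = s ''C'' (int j) + 2 ^ i"
    and fr: "\<forall>x. x \<notin> mods pair_row \<longrightarrow> s1 x = s x"
  have "s1 ''r'' 0 = 3 ^ i" "s1 ''z'' 0 = 2 ^ i"
    using fr z pairs by (simp_all add: pairs_listed_def)
  moreover have "pairs_listed (Suc i) s2"
    if "s2 ''r'' 0 = 3 ^ Suc i" "s2 ''B'' = s1 ''B''" "s2 ''C'' = s1 ''C''" for s2
    by (rule pairs_listed_Suc[OF pairs]) (use row that in auto)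
  ultimately show "runs (Seq (SetVar ''z'' (Plus (Var ''z'') (Var ''z'')))
      (SetVar ''r'' (Plus (Plus (Var ''r'') (Var ''r'')) (Var ''r'')))) s1 17
      (\<lambda>s'. pairs_listed (Suc i) s' \<and> s' ''z'' 0 = 2 ^ Suc i)"
    by (intro runs_loop_free) simp_all
qed (use z in \<open>auto intro: add_cost\<close>)

lemma runs_pair_tables:
  assumes m: "s ''m'' 0 = int m"
  shows "runs pair_tables s (120 * ((m + 1) * 3 ^ m)) (pairs_listed m)"
  unfolding pair_tables_def
proof (rule runs_Seq[where ?T1.0 = 12 and ?T2.0 = "107 * ((m + 1) * 3 ^ m)"])
  let ?Inv = "\<lambda>i s. pairs_listed i s \<and> s ''z'' 0 = 2 ^ i"
  show "runs pair_init s 12 (?Inv 0)"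
    by (rule runs_loop_free) (auto simp: pair_init_def pairs_listed_def disjoint_pair_def)
  fix s1 assume 1: "?Inv 0 s1" and fr1: "\<forall>x. x \<notin> mods pair_init \<longrightarrow> s1 x = s x"
  have "runs (For ''i'' ''m'' pair_step) s1 (107 * ((m + 1) * 3 ^ m)) (?Inv m)"
  proof (rule runs_For[where Inv = ?Inv and B = "86 * 3 ^ m"])
    show "s1 ''m'' 0 = int m" using m fr1 by simp
    show "m * (86 * 3 ^ m + 12) + 9 \<le> 107 * ((m + 1) * 3 ^ m)"
      by (rule loop_cost[where a = 86]) auto
    show "runs pair_step s' (86 * 3 ^ m) (?Inv (Suc j))" if "j < m" "?Inv j s'" for j s'
      by (rule runs_pair_step) (use that in auto)
  qed (use 1 in \<open>auto simp: pairs_listed_def\<close>)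
  then show "runs (For ''i'' ''m'' pair_step) s1 (107 * ((m + 1) * 3 ^ m)) (pairs_listed m)"
    by (rule runs_mono) auto
qed (rule add_cost; simp)

section \<open>Filling the tables of totals, conflicts and maxima\<close>

context clique_modulator
begin

definition sets_listed :: "nat \<Rightarrow> state \<Rightarrow> bool" where
  "sets_listed i s \<longleftrightarrow> s ''p'' 0 = 2 ^ i \<and> (\<forall>S\<subseteq>{..<i}. s ''sm'' (code S) = total S \<and>
     s ''bad'' (code S) = inner_conflicts S \<and> s ''mx'' (code S) = heaviest S)"

lemma runs_set_step:
  assumes inp: "input s" and i: "s ''i'' 0 = int i" "i < m" and sets: "sets_listed i s"
  shows "runs set_step s (200 * ((n + 1) * 3 ^ m)) (sets_listed (Suc i))"
proof -
  have x: "s ''X'' (int i) = int (xs i)" using inp i by (simp add: input_def)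
  show ?thesis
    unfolding set_step_def
  proof (rule runs_Seq[where ?T1.0 = 5 and ?T2.0 = "190 * ((n + 1) * 3 ^ m)"])
    let ?c1 = "SetVar ''u'' (Cell ''X'' (Var ''i''))"
    let ?c2 = "SetVar ''wv'' (Cell ''w'' (Var ''u''))"
    let ?c3 = "SetVar ''p'' (Plus (Var ''p'') (Var ''p''))"
    show "runs ?c1 s 5 (\<lambda>s'. s' ''u'' 0 = int (xs i))"
      by (rule runs_loop_free) (simp_all add: x i)
    fix s1 assume u1: "s1 ''u'' 0 = int (xs i)" and fr1: "\<forall>x. x \<notin> mods ?c1 \<longrightarrow> s1 x = s x"
    have inp1: "input s1" by (rule input_cong[OF inp]) (simp_all add: fr1)
    show "runs (Seq conflict_table (Seq ?c2 (Seq set_row ?c3))) s1 (190 * ((n + 1) * 3 ^ m))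
      (sets_listed (Suc i))"
    proof (rule runs_Seq[where ?T2.0 = "80 * 3 ^ m", OF runs_conflict_table[OF inp1 u1 xs_less[OF i(2)]]])
      fix s2 assume cm2: "\<forall>S\<subseteq>{..<m}. s2 ''cm'' (code S) = conflicts (xs i) S"
        and fr2: "\<forall>x. x \<notin> mods conflict_table \<longrightarrow> s2 x = s1 x"
      have w2: "s2 ''w'' (s2 ''u'' 0) = int (w (xs i))"
        using fr2 u1 inp1 xs_less[OF i(2)] by (simp add: input_def)
      show "runs (Seq ?c2 (Seq set_row ?c3)) s2 (80 * 3 ^ m) (sets_listed (Suc i))"
      proof (rule runs_Seq[where ?T1.0 = 5 and ?T2.0 = "69 * 3 ^ m"])
        show "runs ?c2 s2 5 (\<lambda>s'. s' ''wv'' 0 = int (w (xs i)))"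
          by (rule runs_loop_free) (simp_all add: w2)
        fix s3 assume wv3: "s3 ''wv'' 0 = int (w (xs i))"
          and fr3: "\<forall>x. x \<notin> mods ?c2 \<longrightarrow> s3 x = s2 x"
        have eqs: "s3 ''p'' = s ''p''" "s3 ''sm'' = s ''sm''" "s3 ''bad'' = s ''bad''"
          "s3 ''mx'' = s ''mx''" "s3 ''cm'' = s2 ''cm''"
          by (simp_all add: fr1 fr2 fr3)
        have cm3: "s3 ''cm'' (code S) = conflicts (xs i) S" if "S \<subseteq> {..<i}" for S
        proof -
          \<comment> \<open>The conflict table of \<open>xs i\<close> covers all subsets of
            \<open>{..<m}\<close>; the row reads its part below \<open>2 ^ i\<close>.\<close>
          have "S \<subseteq> {..<m}" using that i(2) by auto
          with cm2 eqs(5) show ?thesis by simp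
        qed
        show "runs (Seq set_row ?c3) s3 (69 * 3 ^ m) (sets_listed (Suc i))"
        proof (rule runs_Seq[where ?T2.0 = 7, OF runs_set_row[where m = m and i = i and F = total
              and H = inner_conflicts and M = heaviest and R = "conflicts (xs i)"]])
          show "s3 ''p'' 0 = 2 ^ i" using sets eqs by (simp add: sets_listed_def)
          fix s4 assume row: "\<forall>S\<subseteq>{..<i}.
              s4 ''sm'' (code S) = total S \<and> s4 ''sm'' (2 ^ i + code S) = total S + int (w (xs i)) \<and>
              s4 ''bad'' (code S) = inner_conflicts S \<and>
              s4 ''bad'' (2 ^ i + code S) = inner_conflicts S + conflicts (xs i) S \<and>
              s4 ''mx'' (code S) = heaviest S \<and>
              s4 ''mx'' (2 ^ i + code S) = max (heaviest S) (int (w (xs i)))"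
            and fr4: "\<forall>x. x \<notin> mods set_row \<longrightarrow> s4 x = s3 x"
          have p4: "s4 ''p'' 0 = 2 ^ i" using sets eqs fr4 by (simp add: sets_listed_def)
          have "s4 ''sm'' (code S) = total S \<and> s4 ''bad'' (code S) = inner_conflicts S \<and>
              s4 ''mx'' (code S) = heaviest S" if "S \<subseteq> {..<Suc i}" for S
            using that
            by (cases rule: subset_lessThan_Suc_cases)
              (use row in \<open>simp_all add: total_insert inner_conflicts_insert heaviest_insert\<close>)
          then show "runs ?c3 s4 7 (sets_listed (Suc i))"
            by (intro runs_loop_free) (simp_all add: p4 sets_listed_def)
        qed (use sets eqs cm3 wv3 i in \<open>auto simp: sets_listed_def intro: add_cost\<close>)
      qed (rule add_cost; simp)
    qed (simp add: algebra_simps)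
  qed (rule add_cost; simp)
qed

lemma runs_set_tables:
  assumes inp: "input s"
  shows "runs set_tables s (240 * ((n + 1) * ((n + 1) * 3 ^ m))) (sets_listed m)"
  unfolding set_tables_def
proof (rule runs_Seq[where ?T1.0 = 12 and ?T2.0 = "221 * ((n + 1) * ((n + 1) * 3 ^ m))"])
  show "runs set_init s 12 (sets_listed 0)"
    by (rule runs_loop_free)
      (auto simp: set_init_def sets_listed_def total_def inner_conflicts_def heaviest_def)
  fix s1 assume 1: "sets_listed 0 s1" and fr1: "\<forall>x. x \<notin> mods set_init \<longrightarrow> s1 x = s x"
  show "runs (For ''i'' ''m'' set_step) s1 (221 * ((n + 1) * ((n + 1) * 3 ^ m))) (sets_listed m)"
  proof (rule runs_For[where Inv = sets_listed and B = "200 * ((n + 1) * 3 ^ m)"])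
    show "s1 ''m'' 0 = int m" using inp fr1 by (simp add: input_def)
    show "m * (200 * ((n + 1) * 3 ^ m) + 12) + 9 \<le> 221 * ((n + 1) * ((n + 1) * 3 ^ m))"
      by (rule loop_cost[where a = 200]) (use m_le_n in auto)
    fix j s' assume j: "j < m" "s' ''i'' 0 = int j" "sets_listed j s'"
      and fr: "\<forall>x. x \<notin> insert ''i'' (mods set_step) \<longrightarrow> s' x = s1 x"
    have "input s'" by (rule input_cong[OF inp]) (simp_all add: fr fr1)
    then show "runs set_step s' (200 * ((n + 1) * 3 ^ m)) (sets_listed (Suc j))"
      using j by (intro runs_set_step)
  qed (use 1 in \<open>auto simp: sets_listed_def\<close>)
qed (rule add_cost; simp)

end

section \<open>The optimization loop\<close>

text \<open>The arrays \<open>g\<close> and \<open>h\<close> hold the new and the previous layer of the dynamic program.\<close>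

definition relax_body :: com where
  "relax_body =
     Seq (SetVar ''b'' (Cell ''B'' (Var ''j'')))
    (Seq (SetVar ''c'' (Cell ''C'' (Var ''j'')))
         (If (Less (Plus (Cell ''bad'' (Var ''b'')) (Cell ''cm'' (Var ''b''))) (Const 1))
           (Seq (If (Less (Cell ''mx'' (Var ''b'')) (Var ''wv''))
                  (SetVar ''mv'' (Var ''wv'')) (SetVar ''mv'' (Cell ''mx'' (Var ''b''))))
           (Seq (SetVar ''val'' (Minus (Plus (Plus (Cell ''h'' (Var ''c'')) (Cell ''sm'' (Var ''b'')))
                  (Var ''wv'')) (Var ''mv'')))
                (If (Less (Cell ''g'' (Plus (Var ''b'') (Var ''c''))) (Var ''val''))
                  (Assign ''g'' (Plus (Var ''b'') (Var ''c'')) (Var ''val'')) Skip)))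
           Skip))"

definition relax :: com where
  "relax = For ''j'' ''r'' relax_body"

definition copy :: com where
  "copy = For ''j'' ''p'' (Assign ''h'' (Var ''j'') (Cell ''g'' (Var ''j'')))"

definition opt_step :: com where
  "opt_step =
     Seq (SetVar ''u'' (Var ''v''))
    (Seq conflict_table
    (Seq (SetVar ''wv'' (Cell ''wp'' (Var ''u'')))
    (Seq copy relax)))"

definition opt_table :: com where
  "opt_table = For ''v'' ''n'' opt_step"

definition solve :: com where
  "solve = Seq set_tables (Seq pair_tables (Seq opt_table
     (If (Less (Cell ''g'' (Minus (Var ''p'') (Const 1))) (Var ''k''))
       (SetVar ''out'' (Const 0)) (SetVar ''out'' (Const 1)))))"

lemma mods_relax_body [simp]: "mods relax_body = {''b'', ''c'', ''mv'', ''val'', ''g''}"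
  by (auto simp: relax_body_def)

lemma mods_relax [simp]: "mods relax = {''j'', ''b'', ''c'', ''mv'', ''val'', ''g''}"
  by (auto simp: relax_def)

lemma mods_copy [simp]: "mods copy = {''j'', ''h''}"
  by (auto simp: copy_def)

lemma mods_opt_step [simp]: "mods opt_step =
    {''u'', ''e'', ''a'', ''f'', ''cm'', ''q'', ''wv'', ''h'', ''j'', ''b'', ''c'', ''mv'', ''val'', ''g''}"
  by (auto simp: opt_step_def)

lemma mods_opt_table [simp]: "mods opt_table =
    {''v'', ''u'', ''e'', ''a'', ''f'', ''cm'', ''q'', ''wv'', ''h'', ''j'', ''b'', ''c'', ''mv'', ''val'', ''g''}"
  by (auto simp: opt_table_def)

text \<open>This is how the machine forms a union without bit operations: no carries arise for
  disjoint sets.\<close>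

lemma code_union: "disjoint_pair i b c \<Longrightarrow> code (b \<union> c) = code b + code c"
  unfolding disjoint_pair_def set_encode_def
  by (subst sum.union_disjoint) (auto intro: finite_subset)

lemma code_eq_iff: "A \<subseteq> {..<i} \<Longrightarrow> B \<subseteq> {..<i} \<Longrightarrow> code A = code B \<longleftrightarrow> A = B"
  using set_encode_eq[of A B] finite_subset[of _ "{..<i}"] by auto

lemma runs_copy:
  assumes p: "s ''p'' 0 = 2 ^ m"
  shows "runs copy s (27 * 3 ^ m) (\<lambda>s'. \<forall>S\<subseteq>{..<m}. s' ''h'' (code S) = s ''g'' (code S))"
proof -
  let ?c = "Assign ''h'' (Var ''j'') (Cell ''g'' (Var ''j''))"
  let ?Inv = "\<lambda>t s'. \<forall>j<t. s' ''h'' (int j) = s ''g'' (int j)"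
  have "runs copy s (27 * 3 ^ m) (?Inv (2 ^ m))"
    unfolding copy_def
  proof (rule runs_For[where Inv = ?Inv and B = 6])
    show "2 ^ m * (6 + 12) + 9 \<le> 27 * (3 ^ m :: nat)"
      using loop_cost[of 6 6 1 "2 ^ m" "3 ^ m" 27] power_le_3_power[of 2 m m] by simp
    fix t s' assume t: "s' ''j'' 0 = int t" and inv: "?Inv t s'"
      and fr: "\<forall>x. x \<notin> insert ''j'' (mods ?c) \<longrightarrow> s' x = s x"
    have "s' ''g'' = s ''g''" using fr by simp
    then show "runs ?c s' 6 (?Inv (Suc t))"
      by (intro runs_loop_free) (use inv t in \<open>auto simp: less_Suc_eq\<close>)
  qed (use p in auto)
  then show ?thesis by (rule runs_mono) (use set_encode_less in auto)
qed

context clique_modulator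
begin

lemma runs_relax_body:
  assumes sets: "sets_listed m s" and wv: "s ''wv'' 0 = rep_weight v"
    and cm: "\<forall>S\<subseteq>{..<m}. s ''cm'' (code S) = conflicts v S"
    and bc: "disjoint_pair m b c" "s ''B'' (s ''j'' 0) = code b" "s ''C'' (s ''j'' 0) = code c"
  shows "runs relax_body s 65 (\<lambda>s'. s' ''g'' = (if compatible b v then (s ''g'')(code (b \<union> c) :=
    max (s ''g'' (code (b \<union> c))) (s ''h'' (code c) + saving b v)) else s ''g''))"
proof (rule runs_loop_free)
  have "b \<subseteq> {..<m}" using bc by (simp add: disjoint_pair_def)
  then have eqs: "s ''sm'' (code b) = total b" "s ''bad'' (code b) = inner_conflicts b"
    "s ''mx'' (code b) = heaviest b" "s ''cm'' (code b) = conflicts v b"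
    using sets cm by (auto simp: sets_listed_def)
  show "loop_free_result relax_body s ''g'' = (if compatible b v then (s ''g'')(code (b \<union> c) :=
    max (s ''g'' (code (b \<union> c))) (s ''h'' (code c) + saving b v)) else s ''g'')"
    unfolding compatible_def saving_def code_union[OF bc(1)]
    by (auto simp: relax_body_def eqs wv bc max_def fun_eq_iff)
qed (simp_all add: relax_body_def)

text \<open>Each entry of \<open>g\<close> is always an attained candidate value and never below a
  candidate already processed; after all pairs it is therefore the maximum. Candidates are read from
  \<open>h\<close>, so entries of \<open>g\<close> already raised do not feed back.\<close>

lemma runs_relax:
  assumes sets: "sets_listed m s" and pairs: "pairs_listed m s" and wv: "s ''wv'' 0 = rep_weight v"
    and cm: "\<forall>S\<subseteq>{..<m}. s ''cm'' (code S) = conflicts v S"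
    and g: "\<forall>S\<subseteq>{..<m}. s ''g'' (code S) = opt v S" and h: "\<forall>S\<subseteq>{..<m}. s ''h'' (code S) = opt v S"
  shows "runs relax s (86 * 3 ^ m) (\<lambda>s'. \<forall>S\<subseteq>{..<m}. s' ''g'' (code S) = opt (Suc v) S)"
proof -
  let ?vals = "\<lambda>A. (\<lambda>T. opt v (A - T) + saving T v) ` {T. T \<subseteq> A \<and> compatible T v}"
  let ?at = "\<lambda>j b c. disjoint_pair m b c \<and> s ''B'' (int j) = code b \<and> s ''C'' (int j) = code c"
  let ?Inv = "\<lambda>t s'. (\<forall>A\<subseteq>{..<m}. s' ''g'' (code A) \<in> ?vals A) \<and>
    (\<forall>j<t. \<forall>b c. ?at j b c \<and> compatible b v \<longrightarrow> opt v c + saving b v \<le> s' ''g'' (code (b \<union> c)))"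
  have "runs relax s (86 * 3 ^ m) (?Inv (3 ^ m))"
    unfolding relax_def
  proof (rule runs_For[where Inv = ?Inv and B = 65])
    show "3 ^ m * (65 + 12) + 9 \<le> 86 * (3 ^ m :: nat)"
      using loop_cost[of 65 65 1 "3 ^ m" "3 ^ m" 86] by simp
    \<comment> \<open>The old layer is the candidate for the empty set, so \<open>g\<close> needs no
      reset.\<close>
    have "opt v A \<in> ?vals A" for A
      by (rule image_eqI[of _ _ "{}"]) simp_all
    then show "?Inv 0 s" using g by simp
    fix t s' assume t: "t < 3 ^ m" "s' ''j'' 0 = int t" and inv: "?Inv t s'"
      and fr: "\<forall>x. x \<notin> insert ''j'' (mods relax_body) \<longrightarrow> s' x = s x"
    obtain b c where bc: "?at t b c" using pairs t(1) unfolding pairs_listed_def by blast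
    then have sub: "b \<subseteq> {..<m}" "c \<subseteq> {..<m}" "b \<union> c \<subseteq> {..<m}" and cb: "b \<union> c - b = c"
      by (auto simp: disjoint_pair_def)
    have eqs: "s' ''B'' = s ''B''" "s' ''C'' = s ''C''" "s' ''h'' = s ''h''" "s' ''wv'' = s ''wv''"
      "s' ''cm'' = s ''cm''" "s' ''p'' = s ''p''" "s' ''sm'' = s ''sm''" "s' ''bad'' = s ''bad''"
      "s' ''mx'' = s ''mx''"
      using fr by simp_all
    have "runs relax_body s' 65 (\<lambda>s''. s'' ''g'' =
        (if compatible b v then (s' ''g'')(code (b \<union> c) :=
          max (s' ''g'' (code (b \<union> c))) (s' ''h'' (code c) + saving b v)) else s' ''g''))"
      by (rule runs_relax_body) (use sets wv cm bc t eqs in \<open>simp_all add: sets_listed_def\<close>)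
    then show "runs relax_body s' 65 (?Inv (Suc t))"
    proof (rule runs_mono)
      fix s'' assume "s'' ''g'' = (if compatible b v then (s' ''g'')(code (b \<union> c) :=
          max (s' ''g'' (code (b \<union> c))) (s' ''h'' (code c) + saving b v)) else s' ''g'')"
      then have g'': "s'' ''g'' = (if compatible b v then (s' ''g'')(code (b \<union> c) :=
          max (s' ''g'' (code (b \<union> c))) (opt v c + saving b v)) else s' ''g'')"
        using h sub(2) eqs(3) by simp
      \<comment> \<open>Entries only grow, so bounds established for earlier pairs persist.\<close>
      have mono: "s' ''g'' x \<le> s'' ''g'' x" for x by (simp add: g'')
      have "s'' ''g'' (code A) \<in> ?vals A" if A: "A \<subseteq> {..<m}" for A
      proof (cases "compatible b v \<and> A = b \<union> c")
        case True
        then have "opt v c + saving b v \<in> ?vals A" using cb by (intro image_eqI[of _ _ b]) auto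
        moreover have "s' ''g'' (code A) \<in> ?vals A" using inv A by blast
        ultimately show ?thesis using True by (simp add: g'' max_def)
      next
        case False
        then have "s'' ''g'' (code A) = s' ''g'' (code A)"
          using code_eq_iff[OF A sub(3)] by (auto simp: g'' simp del: of_nat_eq_iff)
        then show ?thesis using inv A by simp
      qed
      moreover have "opt v c' + saving b' v \<le> s'' ''g'' (code (b' \<union> c'))"
        if j: "j < Suc t" and at: "?at j b' c'" "compatible b' v" for j b' c'
      proof (cases "j = t")
        case True
        then have "code b' = code b" "code c' = code c" using at bc by simp_all
        \<comment> \<open>Codes determine sets below \<open>m\<close>, so position \<open>t\<close>
          holds no other pair.\<close>
        then have "b' = b" "c' = c"
          using at(1) sub code_eq_iff[of _ m] by (auto simp: disjoint_pair_def simp del: of_nat_eq_iff)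
        then show ?thesis using at(2) by (simp add: g'')
      next
        case False
        then have "j < t" using j by simp
        then have "opt v c' + saving b' v \<le> s' ''g'' (code (b' \<union> c'))" using inv at by blast
        then show ?thesis using mono order_trans by blast
      qed
      ultimately show "?Inv (Suc t) s''" by blast
    qed simp
  qed (use pairs in \<open>auto simp: pairs_listed_def\<close>)
  then show ?thesis
  proof (rule runs_mono)
    fix s' assume inv: "?Inv (3 ^ m) s'"
    show "\<forall>S\<subseteq>{..<m}. s' ''g'' (code S) = opt (Suc v) S"
    proof (intro allI impI)
      fix S assume S: "S \<subseteq> {..<m}"
      have "Max (?vals S) = s' ''g'' (code S)"
      proof (rule Max_eqI)
        have "finite S" using S finite_subset by blast
        then show "finite (?vals S)" by simp
        show "s' ''g'' (code S) \<in> ?vals S" using inv S by blast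
        fix y assume "y \<in> ?vals S"
        then obtain T where T: "T \<subseteq> S" "compatible T v" "y = opt v (S - T) + saving T v" by blast
        then have "disjoint_pair m T (S - T)" using S by (auto simp: disjoint_pair_def)
        moreover from this obtain j where "j < 3 ^ m" "?at j T (S - T)"
          using pairs unfolding pairs_listed_def by blast
        ultimately have "y \<le> s' ''g'' (code (T \<union> (S - T)))" using inv T(2,3) by blast
        moreover have "T \<union> (S - T) = S" using T(1) by blast
        ultimately show "y \<le> s' ''g'' (code S)" by simp
      qed
      then show "s' ''g'' (code S) = opt (Suc v) S" by simp
    qed
  qed simp
qed

lemma runs_opt_step:
  assumes inp: "input s" and sets: "sets_listed m s" and pairs: "pairs_listed m s"
    and v: "s ''v'' 0 = int v" "v < n" and g: "\<forall>S\<subseteq>{..<m}. s ''g'' (code S) = opt v S"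
  shows "runs opt_step s (230 * ((n + 1) * 3 ^ m))
    (\<lambda>s'. \<forall>S\<subseteq>{..<m}. s' ''g'' (code S) = opt (Suc v) S)"
    (is "runs _ _ _ ?post")
  unfolding opt_step_def
proof (rule runs_Seq[where ?T1.0 = 4 and ?T2.0 = "226 * ((n + 1) * 3 ^ m)"])
  let ?c1 = "SetVar ''u'' (Var ''v'')"
  let ?c2 = "SetVar ''wv'' (Cell ''wp'' (Var ''u''))"
  show "runs ?c1 s 4 (\<lambda>s'. s' ''u'' 0 = int v)"
    by (rule runs_loop_free) (simp_all add: v)
  fix s1 assume u1: "s1 ''u'' 0 = int v" and fr1: "\<forall>x. x \<notin> mods ?c1 \<longrightarrow> s1 x = s x"
  have inp1: "input s1" by (rule input_cong[OF inp]) (simp_all add: fr1)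
  show "runs (Seq conflict_table (Seq ?c2 (Seq copy relax))) s1 (226 * ((n + 1) * 3 ^ m)) ?post"
  proof (rule runs_Seq[where ?T2.0 = "120 * 3 ^ m", OF runs_conflict_table[OF inp1 u1 v(2)]])
    fix s2 assume cm2: "\<forall>S\<subseteq>{..<m}. s2 ''cm'' (code S) = conflicts v S"
      and fr2: "\<forall>x. x \<notin> mods conflict_table \<longrightarrow> s2 x = s1 x"
    have wp2: "s2 ''wp'' (s2 ''u'' 0) = rep_weight v"
      using fr2 u1 inp1 v(2) by (simp add: input_def)
    show "runs (Seq ?c2 (Seq copy relax)) s2 (120 * 3 ^ m) ?post"
    proof (rule runs_Seq[where ?T1.0 = 5 and ?T2.0 = "113 * 3 ^ m"])
      show "runs ?c2 s2 5 (\<lambda>s'. s' ''wv'' 0 = rep_weight v)"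
        by (rule runs_loop_free) (simp_all add: wp2)
      fix s3 assume wv3: "s3 ''wv'' 0 = rep_weight v" and fr3: "\<forall>x. x \<notin> mods ?c2 \<longrightarrow> s3 x = s2 x"
      have p3: "s3 ''p'' 0 = 2 ^ m" using sets by (simp add: fr1 fr2 fr3 sets_listed_def)
      show "runs (Seq copy relax) s3 (113 * 3 ^ m) ?post"
      proof (rule runs_Seq[OF runs_copy[of s3, OF p3]])
        fix s4 assume h4: "\<forall>S\<subseteq>{..<m}. s4 ''h'' (code S) = s3 ''g'' (code S)"
          and fr4: "\<forall>x. x \<notin> mods copy \<longrightarrow> s4 x = s3 x"
        have eqs: "s4 ''p'' = s ''p''" "s4 ''r'' = s ''r''" "s4 ''sm'' = s ''sm''"
          "s4 ''bad'' = s ''bad''" "s4 ''mx'' = s ''mx''" "s4 ''B'' = s ''B''" "s4 ''C'' = s ''C''"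
          "s4 ''g'' = s ''g''" "s3 ''g'' = s ''g''" "s4 ''cm'' = s2 ''cm''" "s4 ''wv'' = s3 ''wv''"
          by (simp_all add: fr1 fr2 fr3 fr4)
        show "runs relax s4 (86 * 3 ^ m) ?post"
          by (rule runs_relax)
            (use sets pairs g h4 cm2 wv3 in \<open>simp_all add: sets_listed_def pairs_listed_def eqs\<close>)
      qed simp
    qed (rule add_cost; simp)
  qed (simp add: algebra_simps)
qed (rule add_cost; simp)

text \<open>Layer 0 needs no code: cells without input are 0, and so is
  \<open>opt 0 S\<close>.\<close>

lemma runs_opt_table:
  assumes inp: "input s" and sets: "sets_listed m s" and pairs: "pairs_listed m s"
    and g: "s ''g'' = (\<lambda>_. 0)"
  shows "runs opt_table s (251 * ((n + 1) * ((n + 1) * 3 ^ m)))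
    (\<lambda>s'. \<forall>S\<subseteq>{..<m}. s' ''g'' (code S) = opt n S)"
  unfolding opt_table_def
proof (rule runs_For[where Inv = "\<lambda>v s'. \<forall>S\<subseteq>{..<m}. s' ''g'' (code S) = opt v S"
      and B = "230 * ((n + 1) * 3 ^ m)"])
  show "s ''n'' 0 = int n" using inp by (simp add: input_def)
  show "n * (230 * ((n + 1) * 3 ^ m) + 12) + 9 \<le> 251 * ((n + 1) * ((n + 1) * 3 ^ m))"
    by (rule loop_cost[where a = 230]) auto
  fix v s' assume v: "v < n" "s' ''v'' 0 = int v" "\<forall>S\<subseteq>{..<m}. s' ''g'' (code S) = opt v S"
    and fr: "\<forall>x. x \<notin> insert ''v'' (mods opt_step) \<longrightarrow> s' x = s x"
  have "input s'" by (rule input_cong[OF inp]) (simp_all add: fr)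
  moreover have "sets_listed m s'" "pairs_listed m s'"
    using sets pairs by (simp_all add: sets_listed_def pairs_listed_def fr)
  ultimately show "runs opt_step s' (230 * ((n + 1) * 3 ^ m))
      (\<lambda>s'. \<forall>S\<subseteq>{..<m}. s' ''g'' (code S) = opt (Suc v) S)"
    using v by (intro runs_opt_step)
qed (use g in auto)

lemma runs_solve:
  assumes inp: "input s" and g: "s ''g'' = (\<lambda>_. 0)" and k: "s ''k'' 0 = int k"
  shows "runs solve s (700 * ((n + 1) * ((n + 1) * 3 ^ m)))
    (\<lambda>s'. s' ''out'' 0 = (if dual_weighted_coloring G w k then 1 else 0))"
    (is "runs _ _ _ ?post")
  unfolding solve_def
proof (rule runs_Seq[OF runs_set_tables[OF inp]])
  let ?NNP = "(n + 1) * ((n + 1) * 3 ^ m)"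
  let ?fin = "If (Less (Cell ''g'' (Minus (Var ''p'') (Const 1))) (Var ''k''))
    (SetVar ''out'' (Const 0)) (SetVar ''out'' (Const 1))"
  fix s1 assume sets1: "sets_listed m s1" and fr1: "\<forall>x. x \<notin> mods set_tables \<longrightarrow> s1 x = s x"
  have m1: "s1 ''m'' 0 = int m" using inp by (simp add: fr1 input_def)
  show "runs (Seq pair_tables (Seq opt_table ?fin)) s1 (400 * ?NNP) ?post"
  proof (rule runs_Seq[OF runs_pair_tables[of s1, OF m1]])
    fix s2 assume pairs2: "pairs_listed m s2" and fr2: "\<forall>x. x \<notin> mods pair_tables \<longrightarrow> s2 x = s1 x"
    have sets2: "sets_listed m s2" using sets1 by (simp add: sets_listed_def fr2)
    have inp2: "input s2" by (rule input_cong[OF inp]) (simp_all add: fr1 fr2)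
    have g2: "s2 ''g'' = (\<lambda>_. 0)" using g by (simp add: fr1 fr2)
    show "runs (Seq opt_table ?fin) s2 (270 * ?NNP) ?post"
    proof (rule runs_Seq[where ?T2.0 = 12, OF runs_opt_table[OF inp2 sets2 pairs2 g2]])
      fix s3 assume g3: "\<forall>S\<subseteq>{..<m}. s3 ''g'' (code S) = opt n S"
        and fr3: "\<forall>x. x \<notin> mods opt_table \<longrightarrow> s3 x = s2 x"
      \<comment> \<open>The full modulator has the largest code, \<open>2 ^ m - 1\<close>, the last
        cell of the table.\<close>
      have "s3 ''p'' 0 - 1 = code {..<m}"
        using sets2 by (simp add: sets_listed_def fr3 set_encode_lessThan of_nat_diff)
      then have "s3 ''g'' (s3 ''p'' 0 - 1) = opt n {..<m}" using g3 by simp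
      moreover have "s3 ''k'' 0 = int k" using k by (simp add: fr1 fr2 fr3)
      ultimately show "runs ?fin s3 12 ?post"
        by (intro runs_loop_free) (auto simp: dual_weighted_coloring_iff_opt)
    qed (rule add_cost; simp)
  next
    have "(m + 1) * 3 ^ m \<le> ?NNP"
      using m_le_n by (intro mult_le_mono) auto
    then show "120 * ((m + 1) * 3 ^ m) + 270 * ?NNP \<le> 400 * ?NNP" by linarith
  qed
qed simp

end

section \<open>A maximal matching of non-adjacent vertices\<close>

text \<open>The array \<open>wp\<close> holds the weights of the unmatched vertices; since weights are positive, the value
  \<open>0\<close> marks a vertex as matched. It thereby ends up as \<open>rep_weight\<close>.\<close>

definition init_body :: com where
  "init_body =
     Seq (Assign ''row'' (Plus (Var ''u'') (Const 1)) (Plus (Cell ''row'' (Var ''u'')) (Var ''n'')))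
         (Assign ''wp'' (Var ''u'') (Cell ''w'' (Var ''u'')))"

definition init :: com where
  "init = For ''u'' ''n'' init_body"

definition match_body :: com where
  "match_body =
     If (And (And (Less (Var ''u'') (Var ''v'')) (Less (Const 0) (Cell ''wp'' (Var ''u''))))
             (And (Less (Const 0) (Cell ''wp'' (Var ''v'')))
                  (Less (Cell ''adj'' (Plus (Cell ''row'' (Var ''u'')) (Var ''v''))) (Const 1))))
       (Seq (Assign ''X'' (Var ''m'') (Var ''u''))
       (Seq (Assign ''X'' (Plus (Var ''m'') (Const 1)) (Var ''v''))
       (Seq (SetVar ''m'' (Plus (Var ''m'') (Const 2)))
       (Seq (Assign ''wp'' (Var ''u'') (Const 0))
            (Assign ''wp'' (Var ''v'') (Const 0))))))
       Skip"

definition match_row :: com where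
  "match_row = For ''v'' ''n'' match_body"

definition match :: com where
  "match = For ''u'' ''n'' match_row"

definition algorithm :: com where
  "algorithm = Seq init (Seq match
     (If (Less (Var ''m'') (Plus (Var ''k'') (Var ''k''))) solve (SetVar ''out'' (Const 1))))"

lemma mods_init_body [simp]: "mods init_body = {''row'', ''wp''}"
  by (auto simp: init_body_def)

lemma mods_init [simp]: "mods init = {''u'', ''row'', ''wp''}"
  by (auto simp: init_def)

lemma mods_match_body [simp]: "mods match_body = {''X'', ''m'', ''wp''}"
  by (auto simp: match_body_def)

lemma mods_match_row [simp]: "mods match_row = {''v'', ''X'', ''m'', ''wp''}"
  by (auto simp: match_row_def)

lemma mods_match [simp]: "mods match = {''u'', ''v'', ''X'', ''m'', ''wp''}"
  by (auto simp: match_def)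

lemma runs_init:
  assumes n: "s ''n'' 0 = int n" and row: "s ''row'' 0 = 0"
    and w: "\<And>v. v < n \<Longrightarrow> s ''w'' (int v) = int (w v)"
  shows "runs init s (38 * (n + 1))
    (\<lambda>s'. \<forall>v<n. s' ''row'' (int v) = int (v * n) \<and> s' ''wp'' (int v) = int (w v))"
proof -
  \<comment> \<open>\<open>row\<close> is one index ahead of \<open>wp\<close>: round
    \<open>t\<close> writes \<open>row[t + 1]\<close>, starting from the default
    \<open>row[0] = 0\<close>.\<close>
  let ?Inv = "\<lambda>t s'. (\<forall>v\<le>t. s' ''row'' (int v) = int (v * n)) \<and> (\<forall>v<t. s' ''wp'' (int v) = int (w v))"
  have "runs init s (38 * (n + 1)) (?Inv n)"
    unfolding init_def
  proof (rule runs_For[where Inv = ?Inv and B = 17])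
    show "n * (17 + 12) + 9 \<le> 38 * (n + 1)" by simp
    fix t s' assume t: "t < n" "s' ''u'' 0 = int t" and inv: "?Inv t s'"
      and fr: "\<forall>x. x \<notin> insert ''u'' (mods init_body) \<longrightarrow> s' x = s x"
    have eqs: "s' ''n'' 0 = int n" "s' ''w'' (int t) = int (w t)" using n w t by (simp_all add: fr)
    have "loop_free_result init_body s' =
        s'(''row'' := (s' ''row'')(int (Suc t) := int (Suc t * n)), ''wp'' := (s' ''wp'')(int t := int (w t)))"
      using inv by (auto simp: init_body_def eqs t algebra_simps)
    then show "runs init_body s' 17 (?Inv (Suc t))"
      by (intro runs_loop_free) (use inv in \<open>auto simp: init_body_def le_Suc_eq less_Suc_eq algebra_simps\<close>)
  qed (use n row in auto)
  then show ?thesis by (rule runs_mono) auto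
qed

text \<open>\<open>xs\<close> and \<open>M\<close> are ghost data: the list of matched vertices,
  stored in \<open>X\<close>, later enumerates the modulator, while the set of pairs is what can be
  turned into colors.\<close>

definition matching_state ::
  "nat pair_pre_digraph \<Rightarrow> (nat \<Rightarrow> nat) \<Rightarrow> nat \<Rightarrow> nat list \<Rightarrow> nat set set \<Rightarrow> state \<Rightarrow> bool" where
  "matching_state G w n xs M s \<longleftrightarrow>
     s ''m'' 0 = int (length xs) \<and> (\<forall>i<length xs. s ''X'' (int i) = int (xs ! i)) \<and>
     distinct xs \<and> set xs \<subseteq> {..<n} \<and>
     (\<forall>v<n. s ''wp'' (int v) = (if v \<in> set xs then 0 else int (w v))) \<and>
     finite M \<and> disjoint M \<and> \<Union> M = set xs \<and> 2 * card M = length xs \<and>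
     (\<forall>D\<in>M. stable_set G D \<and> (\<exists>a b. D = {a, b} \<and> a \<noteq> b))"

text \<open>Matching more vertices only lowers entries of \<open>wp\<close> to 0, which weakens this
  condition. Pairs once examined thus stay settled, and a single pass gives a maximal
  matching.\<close>

definition saturated :: "nat pair_pre_digraph \<Rightarrow> nat \<Rightarrow> (nat \<times> nat) set \<Rightarrow> state \<Rightarrow> bool" where
  "saturated G n P s \<longleftrightarrow> (\<forall>(a, b)\<in>P. a < b \<longrightarrow> b < n \<longrightarrow>
     0 < s ''wp'' (int a) \<longrightarrow> 0 < s ''wp'' (int b) \<longrightarrow> (a, b) \<in> parcs G)"

definition matrix_given :: "nat pair_pre_digraph \<Rightarrow> nat \<Rightarrow> state \<Rightarrow> bool" where
  "matrix_given G n s \<longleftrightarrow>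
     (\<forall>u<n. \<forall>v<n. s ''adj'' (s ''row'' (int u) + int v) = (if (u, v) \<in> parcs G then 1 else 0))"

lemma runs_match_body:
  assumes G: "pair_graph G" "pverts G = {..<n}"
    and st: "matching_state G w n xs M s" and sat: "saturated G n P s" and adj: "matrix_given G n s"
    and uv: "s ''u'' 0 = int u" "s ''v'' 0 = int v" "u < n" "v < n"
  shows "runs match_body s 54
    (\<lambda>s'. (\<exists>xs M. matching_state G w n xs M s') \<and> saturated G n (insert (u, v) P) s')"
proof (rule runs_loop_free)
  interpret pair_graph G by (rule G(1))
  let ?s = "loop_free_result match_body s"
  let ?test = "u < v \<and> 0 < s ''wp'' (int u) \<and> 0 < s ''wp'' (int v) \<and> (u, v) \<notin> parcs G"
  have adj_uv: "s ''adj'' (s ''row'' (int u) + int v) = (if (u, v) \<in> parcs G then 1 else 0)"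
    using adj uv by (simp add: matrix_given_def)
  show "(\<exists>xs M. matching_state G w n xs M ?s) \<and> saturated G n (insert (u, v) P) ?s"
  proof (cases ?test)
    case False
    then have "?s = s" using uv adj_uv by (auto simp: match_body_def)
    then show ?thesis using st sat False by (auto simp: saturated_def)
  next
    case True
    let ?l = "length xs"
    have m: "s ''m'' 0 = int ?l" using st by (simp add: matching_state_def)
    have s': "?s = s(''X'' := (s ''X'')(int ?l := int u, int ?l + 1 := int v),
        ''m'' := (s ''m'')(0 := int ?l + 2), ''wp'' := (s ''wp'')(int u := 0, int v := 0))"
      using True uv adj_uv m by (auto simp: match_body_def)
    \<comment> \<open>Matched vertices have \<open>wp\<close> equal to 0, which the test
      excludes.\<close>
    have new: "u \<notin> set xs" "v \<notin> set xs" "u \<noteq> v"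
      using True st uv by (auto simp: matching_state_def)
    have sym: "(v, u) \<notin> parcs G"
      using True pair_sym_arcs by (auto simp: symmetric_def dest: symD)
    have irr: "(a, a) \<notin> parcs G" for a using pair_no_loops by fastforce
    have stable: "stable_set G {u, v}"
      using True sym irr uv G(2) by (auto simp: stable_set_def)
    have un: "\<Union> M = set xs" and M: "finite M" "disjoint M" "2 * card M = length xs"
      using st by (auto simp: matching_state_def)
    have notin: "{u, v} \<notin> M" using un new by blast
    have "disjoint (insert {u, v} M)"
      using M(2) un new by (auto simp: pairwise_insert disjnt_def)
    moreover have "?s ''X'' (int i) = int ((xs @ [u, v]) ! i)" if i: "i < length (xs @ [u, v])" for i
    proof -
      have "i < ?l \<or> i = ?l \<or> i = Suc ?l" using i by auto
      then consider "i < ?l" | "i = ?l" | "i = Suc ?l" by blast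
      then show ?thesis
        by cases (use st in \<open>auto simp: s' nth_append matching_state_def\<close>)
    qed
    ultimately have "matching_state G w n (xs @ [u, v]) (insert {u, v} M) ?s"
      unfolding matching_state_def
      using st new uv stable un M notin by (auto simp: s' matching_state_def)
    moreover have "saturated G n (insert (u, v) P) ?s"
      using sat by (auto simp: saturated_def s' split: if_splits)
    ultimately show ?thesis by blast
  qed
qed (simp_all add: match_body_def)

lemma runs_match:
  assumes G: "pair_graph G" "pverts G = {..<n}" and adj: "matrix_given G n s"
    and st: "matching_state G w n xs M s" and n: "s ''n'' 0 = int n"
  shows "runs match s (96 * ((n + 1) * (n + 1)))
    (\<lambda>s'. (\<exists>xs M. matching_state G w n xs M s') \<and> saturated G n {(a, b). a < n} s')"
proof -
  let ?st = "\<lambda>s. \<exists>xs M. matching_state G w n xs M s"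
  have keep: "?st (s(x := z))" "saturated G n P s \<Longrightarrow> saturated G n P (s(x := z))"
    if "?st s" "x \<in> {''u'', ''v''}" for x z s P
    using that by (auto simp: matching_state_def saturated_def)
  let ?Inv = "\<lambda>u s. ?st s \<and> saturated G n {(a, b). a < u} s"
  show ?thesis
    unfolding match_def
  proof (rule runs_For[where Inv = ?Inv and B = "75 * (n + 1)"])
    show "n * (75 * (n + 1) + 12) + 9 \<le> 96 * ((n + 1) * (n + 1))"
      by (rule loop_cost[where a = 75]) auto
    fix u s1 assume u: "u < n" "s1 ''u'' 0 = int u" and inv1: "?Inv u s1"
      and fr1: "\<forall>x. x \<notin> insert ''u'' (mods match_row) \<longrightarrow> s1 x = s x"
    let ?Inv' = "\<lambda>v s. ?st s \<and> saturated G n {(a, b). a < u \<or> a = u \<and> b < v} s"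
    have "runs match_row s1 (75 * (n + 1)) (?Inv' n)"
      unfolding match_row_def
    proof (rule runs_For[where Inv = ?Inv' and B = 54])
      show "s1 ''n'' 0 = int n" using n by (simp add: fr1)
      show "?Inv' 0 s1" using inv1 by simp
      fix v s2 assume v: "v < n" "s2 ''v'' 0 = int v" and inv2: "?Inv' v s2"
        and fr2: "\<forall>x. x \<notin> insert ''v'' (mods match_body) \<longrightarrow> s2 x = s1 x"
      obtain xs M where st2: "matching_state G w n xs M s2" using inv2 by blast
      have "matrix_given G n s2" using adj by (simp add: matrix_given_def fr1 fr2)
      moreover have "s2 ''u'' 0 = int u" using u by (simp add: fr2)
      moreover have "{(a, b). a < u \<or> a = u \<and> b < Suc v}
          = insert (u, v) {(a, b). a < u \<or> a = u \<and> b < v}" by auto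
      ultimately show "runs match_body s2 54 (?Inv' (Suc v))"
        using runs_match_body[OF G st2] inv2 u v by simp
    next
      show "?Inv' j (s(''v'' := z))" if "?Inv' j s" for j s z
        using that keep[of s "''v''"] by simp
    qed auto
    \<comment> \<open>For \<open>a = u\<close> the restriction \<open>b < n\<close> is already part
      of \<open>saturated\<close>, so the row is complete.\<close>
    then show "runs match_row s1 (75 * (n + 1)) (?Inv (Suc u))"
      by (rule runs_mono) (auto simp: saturated_def less_Suc_eq)
  next
    show "?Inv j (s(''u'' := z))" if "?Inv j s" for j s z
      using that keep[of s "''u''"] by simp
    show "?Inv 0 s" using st by (auto simp: saturated_def)
  qed (use n in auto)
qed

text \<open>A pair used as one color saves the smaller of its two weights, which is at least 1
  because weights are positive integers.\<close>

lemma dual_weighted_coloring_if_large_matching: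
  assumes G: "pair_graph G" and pos: "\<And>v. v \<in> pverts G \<Longrightarrow> 0 < w v"
    and M: "finite M" "disjoint M" and k: "k \<le> card M"
    and D: "\<And>D. D \<in> M \<Longrightarrow> stable_set G D \<and> (\<exists>a b. D = {a, b} \<and> a \<noteq> b)"
  shows "dual_weighted_coloring G w k"
proof (rule dual_weighted_coloring_if_disjoint_stable[OF G M(1), where D = "\<lambda>D. D"])
  show "disjoint_family_on (\<lambda>D. D) M"
    using M(2) by (auto simp: disjoint_family_on_def disjoint_def)
  have "1 \<le> (\<Sum>v\<in>D. int (w v)) - int (Max (insert 0 (w ` D)))" if D': "D \<in> M" for D
  proof -
    obtain a b where ab: "D = {a, b}" "a \<noteq> b" and "stable_set G D" using D[OF D'] by blast
    then have "0 < w a" "0 < w b" using pos by (auto simp: stable_set_def)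
    then show ?thesis using ab by (simp add: max_def)
  qed
  then have "int (card M) * 1 \<le> (\<Sum>D\<in>M. (\<Sum>v\<in>D. int (w v)) - int (Max (insert 0 (w ` D))))"
    by (intro sum_bounded_below[where K = 1, simplified, THEN order_trans[rotated]]) auto
  then show "int k \<le> (\<Sum>D\<in>M. (\<Sum>v\<in>D. int (w v)) - int (Max (insert 0 (w ` D))))"
    using k by linarith
qed (use D in auto)

section \<open>Assembling the whole algorithm\<close>

lemma encode_adj:
  assumes "card (pverts G) = n" "u < n" "v < n"
  shows "encode G w k ''adj'' (int (u * n) + int v) = (if (u, v) \<in> parcs G then 1 else 0)"
proof -
  \<comment> \<open>Since both column indices are below \<open>n\<close>, \<open>div\<close> and
    \<open>mod\<close> recover row and column from the position.\<close>
  have "u' = u \<and> v' = v" if "u * n + v = u' * n + v'" "v' < n" for u' v'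
    using arg_cong[OF that(1), of "\<lambda>i. i div n"] arg_cong[OF that(1), of "\<lambda>i. i mod n"] that(2) assms(3)
    by auto
  then show ?thesis
    using assms by (auto simp: encode_def Let_def simp flip: of_nat_add of_nat_mult)
qed

lemma runs_algorithm:
  assumes "dwc_instance G w k" and n_def: "n = card (pverts G)"
  shows "runs algorithm (encode G w k) (1000 * 9 ^ k * ((n + 1) * (n + 1)))
    (\<lambda>s. s ''out'' 0 = (if dual_weighted_coloring G w k then 1 else 0))"
    (is "runs _ ?s _ ?post")
proof -
  have G: "pair_graph G" "pverts G = {..<n}" and pos: "\<And>v. v < n \<Longrightarrow> 0 < w v"
    using assms by (auto simp: dwc_instance_def)
  have enc: "?s ''n'' 0 = int n" "?s ''k'' 0 = int k" "?s ''row'' 0 = 0" "?s ''m'' 0 = 0"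
    "?s ''g'' = (\<lambda>_. 0)" "\<And>v. v < n \<Longrightarrow> ?s ''w'' (int v) = int (w v)"
    by (simp_all add: encode_def n_def Let_def)
  let ?NN = "(n + 1) * (n + 1)"
  let ?If = "If (Less (Var ''m'') (Plus (Var ''k'') (Var ''k''))) solve (SetVar ''out'' (Const 1))"
  show ?thesis
    unfolding algorithm_def
  proof (rule runs_Seq[OF runs_init[where w = w and n = n]])
    fix s1 assume 1: "\<forall>v<n. s1 ''row'' (int v) = int (v * n) \<and> s1 ''wp'' (int v) = int (w v)"
      and fr1: "\<forall>x. x \<notin> mods init \<longrightarrow> s1 x = ?s x"
    have adj1: "matrix_given G n s1"
      using 1 encode_adj[of G n] n_def by (simp add: matrix_given_def fr1)
    have st1: "matching_state G w n [] {} s1"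
      using 1 enc by (simp add: matching_state_def fr1)
    have n1: "s1 ''n'' 0 = int n" using enc by (simp add: fr1)
    show "runs (Seq match ?If) s1 (900 * 9 ^ k * ?NN) ?post"
    proof (rule runs_Seq[OF runs_match[OF G adj1 st1 n1]])
      fix s2 assume 2: "(\<exists>xs M. matching_state G w n xs M s2) \<and> saturated G n {(a, b). a < n} s2"
        and fr2: "\<forall>x. x \<notin> mods match \<longrightarrow> s2 x = s1 x"
      then obtain xs M where st2: "matching_state G w n xs M s2" by blast
      define m where "m = length xs"
      have m2: "s2 ''m'' 0 = int m" using st2 by (simp add: m_def matching_state_def)
      have k2: "s2 ''k'' 0 = int k" using enc by (simp add: fr1 fr2)
      show "runs ?If s2 (800 * 9 ^ k * ?NN) ?post"
      proof (rule runs_If[where T = "700 * 9 ^ k * ?NN"])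
        assume "\<not> bval (Less (Var ''m'') (Plus (Var ''k'') (Var ''k''))) s2"
        then have "k \<le> card M" using m2 k2 st2 by (simp add: matching_state_def m_def)
        then have "dual_weighted_coloring G w k"
          using st2 pos G
          by (intro dual_weighted_coloring_if_large_matching[where M = M]) (auto simp: matching_state_def)
        then show "runs (SetVar ''out'' (Const 1)) s2 (700 * 9 ^ k * ?NN) ?post"
          using add_cost(1)[of "9 ^ k * ?NN" 3 0 700]
          by (intro runs_loop_free) (simp_all add: mult.assoc)
      next
        assume "bval (Less (Var ''m'') (Plus (Var ''k'') (Var ''k''))) s2"
        then have "m \<le> 2 * k" using m2 k2 by simp
        \<comment> \<open>The origin of the base 9: \<open>3 ^ m\<close> pairs with \<open>m\<close>
          at most \<open>2 * k\<close>.\<close>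
        then have "(3 :: nat) ^ m \<le> 3 ^ (2 * k)" by (rule power_increasing) simp
        also have "\<dots> = 9 ^ k" by (simp add: power_mult)
        finally have pow: "(3 :: nat) ^ m \<le> 9 ^ k" .
        have img: "(!) xs ` {..<m} = set xs" by (auto simp: m_def set_conv_nth)
        interpret clique_modulator G w n m "(!) xs"
        proof (rule clique_modulator.intro)
          interpret pair_graph G by (rule G)
          show "inj_on ((!) xs) {..<m}"
            using st2 by (auto simp: matching_state_def m_def inj_on_nth)
          show "xs ! i < n" if "i < m" for i
            using st2 that nth_mem[of i xs] unfolding matching_state_def m_def by blast
          fix u v assume uv: "u < n" "v < n" "u \<noteq> v" "u \<notin> (!) xs ` {..<m}" "v \<notin> (!) xs ` {..<m}"
          then have "0 < s2 ''wp'' (int u)" "0 < s2 ''wp'' (int v)"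
            using st2 pos by (simp_all add: img matching_state_def)
          \<comment> \<open>\<open>saturated\<close> speaks only of pairs in increasing order;
            symmetry of the arcs supplies the other orientation.\<close>
          then have "(u, v) \<in> parcs G \<or> (v, u) \<in> parcs G"
            using 2 uv by (cases "u < v") (auto simp: saturated_def)
          then show "(u, v) \<in> parcs G"
            using pair_sym_arcs by (auto simp: symmetric_def dest: symD)
        qed (rule G)+
        have "input s2"
          unfolding input_def
        proof (intro conjI)
          show "\<forall>u<n. \<forall>v<n. s2 ''adj'' (s2 ''row'' (int u) + int v) = (if (u, v) \<in> parcs G then 1 else 0)"
            using adj1 by (simp add: matrix_given_def fr2)
          show "\<forall>v<n. s2 ''w'' (int v) = int (w v) \<and> s2 ''wp'' (int v) = rep_weight v"
            using st2 enc(6) by (simp add: matching_state_def rep_weight_def img fr1 fr2)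
        qed (use st2 m2 n1 in \<open>simp_all add: matching_state_def m_def fr2\<close>)
        then have "runs solve s2 (700 * ((n + 1) * ((n + 1) * 3 ^ m))) ?post"
          by (rule runs_solve) (use enc k2 in \<open>simp_all add: fr1 fr2\<close>)
        moreover have "700 * ((n + 1) * ((n + 1) * 3 ^ m)) \<le> 700 * 9 ^ k * ?NN"
          using mult_le_mono2[OF pow, of "700 * ?NN"] by (simp only: ac_simps)
        ultimately show "runs solve s2 (700 * 9 ^ k * ?NN) ?post"
          by (rule runs_mono)
      next
        show "1 + bcost (Less (Var ''m'') (Plus (Var ''k'') (Var ''k''))) + 700 * 9 ^ k * ?NN
            \<le> 800 * 9 ^ k * ?NN"
          using add_cost(1)[of "9 ^ k * ?NN" 9 700 800] by (simp add: mult.assoc)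
      qed
    next
      have "1 * ?NN \<le> 9 ^ k * ?NN" by (rule mult_le_mono1) simp
      then show "96 * ?NN + 800 * 9 ^ k * ?NN \<le> 900 * 9 ^ k * ?NN"
        unfolding mult.assoc by linarith
    qed
  next
    have "1 * 1 * (n + 1) \<le> 9 ^ k * (n + 1) * (n + 1)" by (intro mult_le_mono) auto
    then show "38 * (n + 1) + 900 * 9 ^ k * ?NN \<le> 1000 * 9 ^ k * ?NN"
      unfolding mult.assoc by linarith
  qed (use enc in auto)
qed

theorem theorem1:
  shows "\<exists>(c :: com) (C :: nat) (d :: nat). \<forall>G w k. dwc_instance G w k \<longrightarrow>
    (\<exists>t s. exec c (encode G w k) t s \<and>
      s ''out'' 0 = (if dual_weighted_coloring G w k then 1 else 0) \<and>
      t \<le> C * 9 ^ k * (max 1 (card (pverts G))) ^ d)"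
proof (rule exI[of _ algorithm], rule exI[of _ 4000], rule exI[of _ 2], intro allI impI)
  fix G :: "nat pair_pre_digraph" and w :: "nat \<Rightarrow> nat" and k :: nat
  assume inst: "dwc_instance G w k"
  define n where "n = card (pverts G)"
  obtain t s where run: "exec algorithm (encode G w k) t s"
    "t \<le> 1000 * 9 ^ k * ((n + 1) * (n + 1))"
    "s ''out'' 0 = (if dual_weighted_coloring G w k then 1 else 0)"
    using runs_algorithm[OF inst n_def] unfolding runs_def by blast
  \<comment> \<open>Replacing \<open>n + 1\<close> by \<open>2 * max 1 n\<close> also covers the
    empty graph; squaring it turns the constant 1000 into 4000.\<close>
  have "(n + 1) * (n + 1) \<le> (2 * max 1 n) * (2 * max 1 n)"
    by (rule mult_le_mono) auto
  then have "1000 * 9 ^ k * ((n + 1) * (n + 1)) \<le> 1000 * 9 ^ k * ((2 * max 1 n) * (2 * max 1 n))"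
    by (rule mult_le_mono2)
  also have "\<dots> = 4000 * 9 ^ k * max 1 n ^ 2" by (simp add: power2_eq_square)
  finally have "t \<le> 4000 * 9 ^ k * max 1 n ^ 2" using run(2) by linarith
  then show "\<exists>t s. exec algorithm (encode G w k) t s \<and>
      s ''out'' 0 = (if dual_weighted_coloring G w k then 1 else 0) \<and>
      t \<le> 4000 * 9 ^ k * (max 1 (card (pverts G))) ^ 2"
    using run(1,3) unfolding n_def by blast
qed

end
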